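(* Let $n\ge 1$ and suppose $\mathbf{X}=(X_1,\ldots,X_n)$ is a random vector in $\mathbb{R}^n$ with exchangeable components having finite fourth moments. Let $$\hat{\mu} := \frac{1}{n}\sum_{i=1}^{n} X_i, \qquad \hat{\sigma}^2 := \frac{1}{n}\sum_{i=1}^{n}(X_i - \hat{\mu})^2, \qquad \hat\sigma\ge 0.$$ Let $\mathbf{Z}=(Z_1,\ldots,Z_n)$ be a standard Gaussian vector in $\mathbb{R}^n$, independent of $\mathbf{X}$, let $\bar{Z} := \frac{1}{n}\sum_{i=1}^{n} Z_i$, and let $\mathbf{Y}=(Y_1,\ldots,Y_n)$ be given by $$Y_i := \hat{\mu} + \hat{\sigma}(Z_i - \bar{Z}), \qquad i = 1, \ldots, n.$$ Let $f : \mathbb{R}^n \to \mathbb{R}$ be a thrice continuously differentiable function, and for $r = 1, 2, 3$, let $L'_r(f)$ be a (finite) uniform bound on the absolute values of all $r$th order partial derivatives of $f$, including mixed partials. For each $p$, let $m_p = \mathbb{E}|X_1 - \hat{\mu}|^p$. Then $$|\mathbb{E}f(\mathbf{X}) - \mathbb{E}f(\mathbf{Y})| \leq 9.5\, m_4^{1/2}\, L'_2(f)\, n^{1/2} + 13\, m_3\, L'_3(f)\, n.$$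
   Context: The components of $\mathbf{X}$ are exchangeable if $(X_{\pi(1)},\ldots,X_{\pi(n)})$ has the same distribution as $(X_1,\ldots,X_n)$ for every permutation $\pi$ of $\{1,\ldots,n\}$. *)

theory Defs
  imports "HOL-Probability.Probability"
begin

definition exchangeable :: "'a measure \<Rightarrow> ('a \<Rightarrow> real ^ 'n) \<Rightarrow> bool" where
  "exchangeable M X \<longleftrightarrow>
     (\<forall>\<pi>. \<pi> permutes (UNIV :: 'n set) \<longrightarrow>
        distr M borel (\<lambda>\<omega>. \<chi> i. X \<omega> $ \<pi> i) = distr M borel X)"

definition standard_gaussian :: "'a measure \<Rightarrow> ('a \<Rightarrow> real ^ 'n) \<Rightarrow> bool" where
  "standard_gaussian M Z \<longleftrightarrow>
     prob_space.indep_vars M (\<lambda>_. borel) (\<lambda>i \<omega>. Z \<omega> $ i) (UNIV :: 'n set) \<and>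
     (\<forall>i. distributed M lborel (\<lambda>\<omega>. Z \<omega> $ i) std_normal_density)"

definition emp_mean :: "real ^ 'n \<Rightarrow> real" where
  "emp_mean x = (1 / real CARD('n)) * (\<Sum>i\<in>UNIV. x $ i)"

definition emp_sd :: "real ^ 'n \<Rightarrow> real" where
  "emp_sd x = sqrt ((1 / real CARD('n)) * (\<Sum>i\<in>UNIV. (x $ i - emp_mean x)\<^sup>2))"

definition partial_deriv :: "'n \<Rightarrow> (real ^ 'n \<Rightarrow> real) \<Rightarrow> real ^ 'n \<Rightarrow> real" where
  "partial_deriv i f x = deriv (\<lambda>t. f (x + t *\<^sub>R axis i 1)) 0"

definition partially_differentiable :: "'n \<Rightarrow> (real ^ 'n \<Rightarrow> real) \<Rightarrow> real ^ 'n \<Rightarrow> bool" where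
  "partially_differentiable i f x \<longleftrightarrow> (\<lambda>t. f (x + t *\<^sub>R axis i 1)) field_differentiable (at 0)"

text \<open>All partial derivatives of order at most \<open>k\<close> exist everywhere and are continuous.\<close>

primrec cont_diff :: "nat \<Rightarrow> (real ^ 'n \<Rightarrow> real) \<Rightarrow> bool" where
  "cont_diff 0 f \<longleftrightarrow> continuous_on UNIV f"
| "cont_diff (Suc k) f \<longleftrightarrow> continuous_on UNIV f \<and>
     (\<forall>i. (\<forall>x. partially_differentiable i f x) \<and> cont_diff k (partial_deriv i f))"

primrec iter_partial :: "'n list \<Rightarrow> (real ^ 'n \<Rightarrow> real) \<Rightarrow> real ^ 'n \<Rightarrow> real" where
  "iter_partial [] f = f"
| "iter_partial (i # is) f = partial_deriv i (iter_partial is f)"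

definition bounds_partials :: "nat \<Rightarrow> (real ^ 'n \<Rightarrow> real) \<Rightarrow> real \<Rightarrow> bool" where
  "bounds_partials r f B \<longleftrightarrow> (\<forall>is x. length is = r \<longrightarrow> \<bar>iter_partial is f x\<bar> \<le> B)"

end

theory Submission
  imports Defs "HOL-Real_Asymp.Real_Asymp"
begin

text \<open>
  Given the empirical distribution of its components, an exchangeable vector is a uniformly random
  permutation \<open>y\<close> of a fixed vector \<open>x\<close>, which may be assumed to be centered; let \<open>v\<close> be its
  empirical variance and \<open>G\<close> the centered Gaussian vector with the same covariance structure.
  Interpolate along \<open>W \<theta> = sin \<theta> *\<^sub>R y + cos \<theta> *\<^sub>R G\<close> for \<open>0 \<le> \<theta> \<le> pi / 2\<close>.  In the derivative of
  the expectation of \<open>f (W \<theta>)\<close>, the Gaussian terms are treated by integration by parts, and the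
  terms in \<open>y\<close> by a discrete analogue: \<open>y $ i\<close> is the average over \<open>j\<close> of \<open>y $ i - y $ j\<close>, and
  these differences change sign when \<open>i\<close> and \<open>j\<close> are exchanged.  The second-order terms agree up
  to quantities that are again antisymmetric under such exchanges, so a second exchange replaces them
  by third derivatives; only the terms with coinciding indices, which no exchange makes cancel, are
  bounded by second derivatives.  This gives the constants \<open>2\<close> and \<open>32 / 3\<close>.
\<close>

section \<open>Averages over permutations\<close>

text \<open>The trigonometric weights are chosen so that second-order terms match. Gaussian
  integration by parts turns the weight \<open>- sin \<theta>\<close> of the derivative into a
  factor sin \<theta> cos \<theta>, and the expansion in sin \<theta> times y, whose weight is cos
  \<theta>, produces the same factor. What remains is the gap between the empirical (y_i - y_j)^2 /
  2 and its mean value v. The obstacle is that the coordinates of y are dependent: the discrete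
  identity holds only after summing over all permutations, with the Gaussian vector frozen, whereas
  the Gaussian one needs the expectation with the permutation frozen. Independence and finiteness of
  the permutation group allow both. At angle \<theta> the error is at most cos \<theta> (32 sin^2
  \<theta> L3 S + 4 sin \<theta> L2 v), where S is the sum of the cubes |x_i|^3; integrating gives
  32/3 L3 S + 2 L2 v. Taking expectations, S becomes n m_3 and v becomes m_2, which is at most
  m_4^(1/2).\<close>

definition permute_vec :: "('n \<Rightarrow> 'n) \<Rightarrow> real ^ 'n \<Rightarrow> real ^ 'n" where
  "permute_vec p x = (\<chi> i. x $ p i)"

lemma permute_vec_nth [simp]: "permute_vec p x $ i = x $ p i"
  by (simp add: permute_vec_def)

abbreviation swap_vec :: "'n \<Rightarrow> 'n \<Rightarrow> real ^ 'n \<Rightarrow> real ^ 'n" where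
  "swap_vec i j \<equiv> permute_vec (Transposition.transpose i j)"

lemma sum_permute_vec_nth:
  assumes "p permutes UNIV"
  shows "(\<Sum>i\<in>UNIV. g (permute_vec p x $ i)) = (\<Sum>i\<in>UNIV. g (x $ i))"
  using sum.permute[OF assms, of "\<lambda>i. g (x $ i)"] by (simp add: o_def)

definition perms :: "('n \<Rightarrow> 'n) set" where
  "perms = {p. p permutes UNIV}"

lemma card_perms_pos: "0 < card (perms :: ('n::finite \<Rightarrow> 'n) set)"
  by (simp add: perms_def card_permutations)

text \<open>Right composition with a transposition is a bijection of the permutation group. This
  invariance replaces independence throughout the discrete argument.\<close>

lemma sum_perms_swap:
  fixes x :: "real ^ 'n" and h :: "real ^ 'n \<Rightarrow> real"
  shows "(\<Sum>p\<in>perms. h (swap_vec i j (permute_vec p x))) = (\<Sum>p\<in>perms. h (permute_vec p x))"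
proof -
  have "swap_vec i j (permute_vec p x) = permute_vec (p \<circ> Transposition.transpose i j) x" for p
    by (simp add: vec_eq_iff)
  then show ?thesis
    using sum_permutations_compose_right[OF permutes_swap_id[of i UNIV j],
        of "\<lambda>p. h (permute_vec p x)"]
    by (simp add: perms_def)
qed

text \<open>The sum equals its image under the exchange; the right-hand side is the mean of the two,
  which is the origin of the factor 1/2.\<close>

lemma sum_perms_antisym:
  fixes x :: "real ^ 'n" and a b :: "real ^ 'n \<Rightarrow> real"
  assumes "\<And>y. a (swap_vec i j y) = - a y"
  shows "(\<Sum>p\<in>perms. a (permute_vec p x) * b (permute_vec p x)) =
    (\<Sum>p\<in>perms. a (permute_vec p x) * (b (permute_vec p x) - b (swap_vec i j (permute_vec p x)))) / 2"
  using sum_perms_swap[of "\<lambda>y. a y * b y" i j x]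
  by (simp add: assms right_diff_distrib sum_subtractf sum_negf)

text \<open>Each exchange trades the value of \<open>b\<close> for its increment and so gains one
  factor of the order of a coordinate. Applied to an \<open>a\<close> that is quadratic in
  \<open>y\<close>, this yields the cubic terms of the final estimate.\<close>

lemma sum_perms_antisym_bound:
  fixes x :: "real ^ 'n" and a b :: "real ^ 'n \<Rightarrow> real"
  assumes a: "\<And>y. a (swap_vec i j y) = - a y"
    and b: "\<And>y. \<bar>b y - b (swap_vec i j y)\<bar> \<le> K * \<bar>y $ i - y $ j\<bar>"
  shows "\<bar>\<Sum>p\<in>perms. a (permute_vec p x) * b (permute_vec p x)\<bar> \<le>
    (\<Sum>p\<in>perms. K / 2 * (\<bar>a (permute_vec p x)\<bar> * \<bar>permute_vec p x $ i - permute_vec p x $ j\<bar>))"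
proof -
  have "\<bar>a y * (b y - b (swap_vec i j y)) / 2\<bar> \<le> K / 2 * (\<bar>a y\<bar> * \<bar>y $ i - y $ j\<bar>)" for y
    using mult_left_mono[OF b, of "\<bar>a y\<bar>" y] by (simp add: abs_mult mult_ac)
  then show ?thesis
    unfolding sum_perms_antisym[of a, OF a] sum_divide_distrib
    by (intro order.trans[OF sum_abs] sum_mono) blast
qed

section \<open>Elementary inequalities that separate mixed cubic and quadratic terms\<close>

lemma add_power3_le:
  fixes a b :: real
  assumes "0 \<le> a" "0 \<le> b"
  shows "(a + b) ^ 3 \<le> 4 * (a ^ 3 + b ^ 3)"
proof -
  \<comment> \<open>This product is exactly the right-hand side minus the left-hand side.\<close>
  have "0 \<le> 3 * (a + b) * (a - b)\<^sup>2" using assms by simp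
  then show ?thesis by (simp add: power2_eq_square power3_eq_cube algebra_simps)
qed

lemma abs_diff_power3_le:
  fixes a b :: real
  shows "\<bar>a - b\<bar> ^ 3 \<le> 4 * (\<bar>a\<bar> ^ 3 + \<bar>b\<bar> ^ 3)"
  by (rule order.trans[OF power_mono[OF abs_triangle_ineq4] add_power3_le]) auto

lemma abs_diff_squares_mult_le:
  fixes a b :: real
  shows "\<bar>a\<^sup>2 - b\<^sup>2\<bar> * \<bar>a - b\<bar> \<le> 4 * (\<bar>a\<bar> ^ 3 + \<bar>b\<bar> ^ 3)"
proof -
  have "\<bar>a\<^sup>2 - b\<^sup>2\<bar> * \<bar>a - b\<bar> = \<bar>a + b\<bar> * (\<bar>a - b\<bar> * \<bar>a - b\<bar>)"
    by (simp add: power2_eq_square square_diff_square_factored abs_mult)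
  also have "\<dots> \<le> (\<bar>a\<bar> + \<bar>b\<bar>) * ((\<bar>a\<bar> + \<bar>b\<bar>) * (\<bar>a\<bar> + \<bar>b\<bar>))"
    by (intro mult_mono abs_triangle_ineq abs_triangle_ineq4) auto
  also have "\<dots> = (\<bar>a\<bar> + \<bar>b\<bar>) ^ 3" by (simp add: power3_eq_cube)
  also have "\<dots> \<le> 4 * (\<bar>a\<bar> ^ 3 + \<bar>b\<bar> ^ 3)" by (rule add_power3_le) auto
  finally show ?thesis .
qed

lemma square_mult_le:
  fixes p q :: real
  assumes "0 \<le> p" "0 \<le> q"
  shows "p\<^sup>2 * q \<le> (2 * p ^ 3 + q ^ 3) / 3"
proof -
  \<comment> \<open>The product expands to \<open>2 * p ^ 3 + q ^ 3 - 3 * (p\<^sup>2 * q)\<close>;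
    the bound is the arithmetic-geometric mean inequality for the cubes of p, p, q.\<close>
  have "0 \<le> (p - q)\<^sup>2 * (2 * p + q)" using assms by simp
  then show ?thesis by (simp add: power2_eq_square power3_eq_cube algebra_simps)
qed

lemma diff_square_mult_le:
  fixes a b c :: real
  shows "(a - b)\<^sup>2 * \<bar>c\<bar> \<le> 4 / 3 * (\<bar>a\<bar> ^ 3 + \<bar>b\<bar> ^ 3 + \<bar>c\<bar> ^ 3)"
proof -
  have "(a - b)\<^sup>2 \<le> 2 * \<bar>a\<bar>\<^sup>2 + 2 * \<bar>b\<bar>\<^sup>2"
    using zero_le_power2[of "a + b"] by (simp add: power2_eq_square algebra_simps)
  then have "(a - b)\<^sup>2 * \<bar>c\<bar> \<le> (2 * \<bar>a\<bar>\<^sup>2 + 2 * \<bar>b\<bar>\<^sup>2) * \<bar>c\<bar>"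
    by (rule mult_right_mono) simp
  also have "\<dots> = 2 * (\<bar>a\<bar>\<^sup>2 * \<bar>c\<bar>) + 2 * (\<bar>b\<bar>\<^sup>2 * \<bar>c\<bar>)"
    by (simp only: distrib_right mult.assoc)
  also have "\<dots> \<le> 2 * ((2 * \<bar>a\<bar> ^ 3 + \<bar>c\<bar> ^ 3) / 3) + 2 * ((2 * \<bar>b\<bar> ^ 3 + \<bar>c\<bar> ^ 3) / 3)"
    by (intro add_mono mult_left_mono square_mult_le) auto
  also have "\<dots> = 4 / 3 * (\<bar>a\<bar> ^ 3 + \<bar>b\<bar> ^ 3 + \<bar>c\<bar> ^ 3)" by (simp add: field_simps)
  finally show ?thesis .
qed

lemma abs_diff_mult_le:
  fixes a b :: real
  shows "\<bar>a - b\<bar> * \<bar>a\<bar> \<le> 3 / 2 * a\<^sup>2 + 1 / 2 * b\<^sup>2"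
proof -
  have "\<bar>a - b\<bar> * \<bar>a\<bar> \<le> (\<bar>a\<bar> + \<bar>b\<bar>) * \<bar>a\<bar>"
    by (intro mult_right_mono abs_triangle_ineq4) auto
  also have "\<dots> \<le> 3 / 2 * \<bar>a\<bar>\<^sup>2 + 1 / 2 * \<bar>b\<bar>\<^sup>2"
    using zero_le_power2[of "\<bar>a\<bar> - \<bar>b\<bar>"] by (simp add: power2_eq_square algebra_simps)
  finally show ?thesis by simp
qed

lemma double_sum_add:
  fixes g h :: "'n::finite \<Rightarrow> real"
  shows "(\<Sum>i\<in>UNIV. \<Sum>k\<in>UNIV. c * (g i + h k)) = c * real CARD('n) * (sum g UNIV + sum h UNIV)"
  by (simp only: sum_distrib_left[symmetric] sum.distrib)
     (simp flip: sum_distrib_left, simp add: algebra_simps)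

lemma triple_sum_add:
  fixes g :: "'n::finite \<Rightarrow> real"
  shows "(\<Sum>i\<in>UNIV. \<Sum>j\<in>UNIV. \<Sum>k\<in>UNIV. c * (g i + g k + g j)) = c * (real CARD('n))\<^sup>2 * (3 * sum g UNIV)"
  by (simp only: sum_distrib_left[symmetric] sum.distrib)
     (simp flip: sum_distrib_left, simp add: power2_eq_square algebra_simps)

section \<open>Discrete integration by parts for the permutations of a centered vector\<close>

context
  fixes x :: "real ^ 'n" and v S K :: real
  assumes sum_zero: "(\<Sum>i\<in>UNIV. x $ i) = 0"
    and sum_squares: "(\<Sum>i\<in>UNIV. (x $ i)\<^sup>2) = real CARD('n) * v"
    and sum_cubes: "(\<Sum>i\<in>UNIV. \<bar>x $ i\<bar> ^ 3) = S"
    and K_nonneg: "0 \<le> K"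
begin

lemma perms_sums:
  assumes "p \<in> perms"
  shows "(\<Sum>i\<in>UNIV. permute_vec p x $ i) = 0"
    and "(\<Sum>i\<in>UNIV. (permute_vec p x $ i)\<^sup>2) = real CARD('n) * v"
    and "(\<Sum>i\<in>UNIV. \<bar>permute_vec p x $ i\<bar> ^ 3) = S"
  using assms sum_permute_vec_nth[of p "\<lambda>t. t" x] sum_permute_vec_nth[of p "\<lambda>t. t\<^sup>2" x]
    sum_permute_vec_nth[of p "\<lambda>t. \<bar>t\<bar> ^ 3" x]
  by (simp_all only: perms_def mem_Collect_eq sum_zero sum_squares sum_cubes)

text \<open>As \<open>v\<close> is the mean of the squares, n times (y_i^2 - v) is the sum over k of
  y_i^2 - y_k^2, and each such difference changes sign when i and k are exchanged. A pair costs 2 K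
  (|y_i|^3 + |y_k|^3); the n^2 pairs cost 4 K n S, and the factor n is divided out.\<close>

lemma sum_perms_centered_square:
  fixes H :: "'n \<Rightarrow> real ^ 'n \<Rightarrow> real"
  assumes H: "\<And>i k y. \<bar>H i y - H i (swap_vec i k y)\<bar> \<le> K * \<bar>y $ i - y $ k\<bar>"
  shows "\<bar>\<Sum>p\<in>perms. \<Sum>i\<in>UNIV. ((permute_vec p x $ i)\<^sup>2 - v) * H i (permute_vec p x)\<bar>
    \<le> real (card (perms :: ('n \<Rightarrow> 'n) set)) * (4 * K * S)"
proof -
  let ?y = "\<lambda>p. permute_vec p x" and ?N = "real CARD('n)"
  let ?P = "perms :: ('n \<Rightarrow> 'n) set"
  have "?N * (\<Sum>p\<in>?P. \<Sum>i\<in>UNIV. ((?y p $ i)\<^sup>2 - v) * H i (?y p))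
      = (\<Sum>p\<in>?P. \<Sum>i\<in>UNIV. \<Sum>k\<in>UNIV. ((?y p $ i)\<^sup>2 - (?y p $ k)\<^sup>2) * H i (?y p))"
    unfolding sum_distrib_left
    by (intro sum.cong refl)
       (simp add: sum_distrib_right[symmetric] sum_subtractf perms_sums del: permute_vec_nth,
        simp add: algebra_simps)
  also have "\<dots> = (\<Sum>i\<in>UNIV. \<Sum>k\<in>UNIV. \<Sum>p\<in>?P. ((?y p $ i)\<^sup>2 - (?y p $ k)\<^sup>2) * H i (?y p))"
    by (subst sum.swap, rule sum.cong[OF refl], rule sum.swap)
  finally have "\<bar>?N * (\<Sum>p\<in>?P. \<Sum>i\<in>UNIV. ((?y p $ i)\<^sup>2 - v) * H i (?y p))\<bar> = \<bar>\<dots>\<bar>" by (rule arg_cong)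
  also have "\<dots> \<le> (\<Sum>i\<in>UNIV. \<Sum>k\<in>UNIV. \<Sum>p\<in>?P.
      K / 2 * (4 * (\<bar>?y p $ i\<bar> ^ 3 + \<bar>?y p $ k\<bar> ^ 3)))"
  proof (rule order.trans[OF sum_abs], rule sum_mono, rule order.trans[OF sum_abs], rule sum_mono)
    fix i k :: 'n
    have "\<bar>\<Sum>p\<in>?P. ((?y p $ i)\<^sup>2 - (?y p $ k)\<^sup>2) * H i (?y p)\<bar>
      \<le> (\<Sum>p\<in>?P. K / 2 * (\<bar>(?y p $ i)\<^sup>2 - (?y p $ k)\<^sup>2\<bar> * \<bar>?y p $ i - ?y p $ k\<bar>))"
      by (rule sum_perms_antisym_bound[of "\<lambda>y. (y $ i)\<^sup>2 - (y $ k)\<^sup>2" i k "H i" K x]) (use H in auto)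
    also have "\<dots> \<le> (\<Sum>p\<in>?P. K / 2 * (4 * (\<bar>?y p $ i\<bar> ^ 3 + \<bar>?y p $ k\<bar> ^ 3)))"
      by (intro sum_mono mult_left_mono abs_diff_squares_mult_le) (use K_nonneg in auto)
    finally show "\<bar>\<Sum>p\<in>?P. ((?y p $ i)\<^sup>2 - (?y p $ k)\<^sup>2) * H i (?y p)\<bar>
      \<le> (\<Sum>p\<in>?P. K / 2 * (4 * (\<bar>?y p $ i\<bar> ^ 3 + \<bar>?y p $ k\<bar> ^ 3)))" .
  qed
  also have "\<dots> = (\<Sum>p\<in>?P. \<Sum>i\<in>UNIV. \<Sum>k\<in>UNIV. K / 2 * (4 * (\<bar>?y p $ i\<bar> ^ 3 + \<bar>?y p $ k\<bar> ^ 3)))"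
    by (rule sym, subst sum.swap, rule sum.cong[OF refl], rule sum.swap)
  also have "\<dots> = (\<Sum>p\<in>?P. ?N * (4 * K * S))"
    by (intro sum.cong refl)
       (simp only: mult.assoc[symmetric] double_sum_add perms_sums, simp)
  also have "\<dots> = ?N * (real (card ?P) * (4 * K * S))" by simp
  finally show ?thesis by (simp only: abs_mult abs_of_nat) simp
qed

text \<open>Since the coordinates sum to zero, y_i is the mean over k of y_i - y_k. The product (y_i
  - y_k) y_j is antisymmetric under the exchange of i and k only if j differs from both. The
  coincidences j = i and j = k have no such cancellation and are bounded through \<open>B\<close>,
  each costing 2 n^2 B v; this is the only source of the second-derivative term in the final bound.
  One factor n survives here and is cancelled by the prefactor 1/n of this sum in the decomposition
  below.\<close>

lemma sum_perms_products:
  fixes H :: "'n \<Rightarrow> 'n \<Rightarrow> real ^ 'n \<Rightarrow> real"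
  assumes H: "\<And>i j k l y. \<bar>H i j y - H i j (swap_vec k l y)\<bar> \<le> K * \<bar>y $ k - y $ l\<bar>"
    and B: "\<And>i j y. \<bar>H i j y\<bar> \<le> B"
  shows "\<bar>\<Sum>p\<in>perms. \<Sum>i\<in>UNIV. \<Sum>j\<in>UNIV.
      permute_vec p x $ i * permute_vec p x $ j * H i j (permute_vec p x)\<bar>
    \<le> real (card (perms :: ('n \<Rightarrow> 'n) set)) * (real CARD('n) * (4 * B * v + 2 * K * S))"
proof -
  let ?y = "\<lambda>p. permute_vec p x" and ?N = "real CARD('n)"
  let ?P = "perms :: ('n \<Rightarrow> 'n) set"
  have B0: "0 \<le> B" using B[of undefined undefined undefined] by linarith
  let ?D = "\<lambda>p i k. 3 / 2 * (?y p $ i)\<^sup>2 + 1 / 2 * (?y p $ k)\<^sup>2"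
  \<comment> \<open>One nonnegative majorant for all index triples: the cubic part serves distinct
    j, the two conditional parts serve the coincidences. Keeping the cubic part for every triple,
    and both conditional parts when i = j = k, only enlarges the bound and makes the sums
    factor.\<close>
  let ?T = "\<lambda>p i j k. K / 2 * (4 / 3 * (\<bar>?y p $ i\<bar> ^ 3 + \<bar>?y p $ k\<bar> ^ 3 + \<bar>?y p $ j\<bar> ^ 3))
    + ((if j = i then B * ?D p i k else 0) + (if j = k then B * ?D p k i else 0))"
  have "?N * (\<Sum>p\<in>?P. \<Sum>i\<in>UNIV. \<Sum>j\<in>UNIV. ?y p $ i * ?y p $ j * H i j (?y p))
      = (\<Sum>p\<in>?P. \<Sum>i\<in>UNIV. \<Sum>j\<in>UNIV. \<Sum>k\<in>UNIV. ((?y p $ i - ?y p $ k) * ?y p $ j) * H i j (?y p))"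
    unfolding sum_distrib_left
    by (intro sum.cong refl)
       (simp add: sum_distrib_right[symmetric] sum_subtractf perms_sums del: permute_vec_nth)
  also have "\<dots> = (\<Sum>i\<in>UNIV. \<Sum>j\<in>UNIV. \<Sum>k\<in>UNIV. \<Sum>p\<in>?P. ((?y p $ i - ?y p $ k) * ?y p $ j) * H i j (?y p))"
    by (subst sum.swap, rule sum.cong[OF refl], subst sum.swap, rule sum.cong[OF refl], rule sum.swap)
  finally have "\<bar>?N * (\<Sum>p\<in>?P. \<Sum>i\<in>UNIV. \<Sum>j\<in>UNIV. ?y p $ i * ?y p $ j * H i j (?y p))\<bar> = \<bar>\<dots>\<bar>" by (rule arg_cong)
  also have "\<dots> \<le> (\<Sum>i\<in>UNIV. \<Sum>j\<in>UNIV. \<Sum>k\<in>UNIV. \<Sum>p\<in>?P. ?T p i j k)"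
  proof (rule order.trans[OF sum_abs], rule sum_mono, rule order.trans[OF sum_abs], rule sum_mono,
      rule order.trans[OF sum_abs], rule sum_mono)
    fix i j k :: 'n
    have D0: "0 \<le> B * ?D p i k" for p i k using B0 by simp
    have T0: "0 \<le> K / 2 * (4 / 3 * (\<bar>?y p $ i\<bar> ^ 3 + \<bar>?y p $ k\<bar> ^ 3 + \<bar>?y p $ j\<bar> ^ 3))" for p
      using K_nonneg by simp
    show "\<bar>\<Sum>p\<in>?P. ((?y p $ i - ?y p $ k) * ?y p $ j) * H i j (?y p)\<bar> \<le> (\<Sum>p\<in>?P. ?T p i j k)"
    proof (cases "j = i \<or> j = k")
      case True
      have "\<bar>((?y p $ i - ?y p $ k) * ?y p $ j) * H i j (?y p)\<bar> \<le> ?T p i j k" for p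
      proof -
        have "\<bar>((?y p $ i - ?y p $ k) * ?y p $ j) * H i j (?y p)\<bar>
          \<le> B * (\<bar>?y p $ i - ?y p $ k\<bar> * \<bar>?y p $ j\<bar>)"
          using mult_right_mono[OF B[of i j "?y p"], of "\<bar>?y p $ i - ?y p $ k\<bar> * \<bar>?y p $ j\<bar>"]
          by (simp add: abs_mult mult_ac del: permute_vec_nth)
        also have "\<dots> \<le> (if j = i then B * ?D p i k else 0) + (if j = k then B * ?D p k i else 0)"
        proof (cases "j = i")
          case True
          then have "B * (\<bar>?y p $ i - ?y p $ k\<bar> * \<bar>?y p $ j\<bar>) \<le> B * ?D p i k"
            using abs_diff_mult_le[of "?y p $ i" "?y p $ k"] B0 by (intro mult_left_mono) auto
          then show ?thesis using True D0[of p k i] by auto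
        next
          case False
          then have "j = k" using \<open>j = i \<or> j = k\<close> by simp
          then have "B * (\<bar>?y p $ i - ?y p $ k\<bar> * \<bar>?y p $ j\<bar>) \<le> B * ?D p k i"
            using abs_diff_mult_le[of "?y p $ k" "?y p $ i"] B0
            by (intro mult_left_mono) (auto simp: abs_minus_commute)
          then show ?thesis using False \<open>j = k\<close> by auto
        qed
        finally show ?thesis using T0[of p] by linarith
      qed
      then show ?thesis by (intro order.trans[OF sum_abs] sum_mono)
    next
      case False
      have "\<bar>\<Sum>p\<in>?P. ((?y p $ i - ?y p $ k) * ?y p $ j) * H i j (?y p)\<bar>
        \<le> (\<Sum>p\<in>?P. K / 2 * (\<bar>(?y p $ i - ?y p $ k) * ?y p $ j\<bar> * \<bar>?y p $ i - ?y p $ k\<bar>))"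
        by (rule sum_perms_antisym_bound[of "\<lambda>y. (y $ i - y $ k) * y $ j" i k "H i j" K x])
           (use H False in \<open>auto simp: algebra_simps Transposition.transpose_def\<close>)
      also have "\<dots> = (\<Sum>p\<in>?P. K / 2 * ((?y p $ i - ?y p $ k)\<^sup>2 * \<bar>?y p $ j\<bar>))"
        by (intro sum.cong refl) (simp only: abs_mult mult.assoc mult.left_commute[of "\<bar>_ $ j\<bar>"] abs_mult_self_eq power2_eq_square mult.commute[of _ "\<bar>_ $ j\<bar>"])
      also have "\<dots> \<le> (\<Sum>p\<in>?P. K / 2 * (4 / 3 * (\<bar>?y p $ i\<bar> ^ 3 + \<bar>?y p $ k\<bar> ^ 3 + \<bar>?y p $ j\<bar> ^ 3)))"
        by (intro sum_mono mult_left_mono diff_square_mult_le) (use K_nonneg in auto)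
      also have "\<dots> = (\<Sum>p\<in>?P. ?T p i j k)" using False by (intro sum.cong refl) auto
      finally show ?thesis .
    qed
  qed
  also have "\<dots> = (\<Sum>p\<in>?P. \<Sum>i\<in>UNIV. \<Sum>j\<in>UNIV. \<Sum>k\<in>UNIV. ?T p i j k)"
    by (rule sym, subst sum.swap, rule sum.cong[OF refl], subst sum.swap, rule sum.cong[OF refl], rule sum.swap)
  also have "\<dots> = (\<Sum>p\<in>?P. ?N\<^sup>2 * (4 * B * v + 2 * K * S))"
  proof (intro sum.cong refl)
    fix p assume p: "p \<in> ?P"
    let ?a = "?y p"
    have 1: "(\<Sum>i\<in>UNIV. \<Sum>j\<in>UNIV. \<Sum>k\<in>UNIV. K / 2 * (4 / 3 * (\<bar>?a $ i\<bar> ^ 3 + \<bar>?a $ k\<bar> ^ 3 + \<bar>?a $ j\<bar> ^ 3)))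
      = ?N\<^sup>2 * (2 * K * S)"
      by (simp only: mult.assoc[symmetric] triple_sum_add perms_sums[OF p]) simp
    have 2: "(\<Sum>i\<in>UNIV. \<Sum>k\<in>UNIV. B * ?D p i k) = ?N\<^sup>2 * (2 * B * v)"
      by (subst double_sum_add, simp only: sum_distrib_left[symmetric] perms_sums[OF p])
         (simp add: power2_eq_square algebra_simps)
    have 3: "(\<Sum>i\<in>UNIV. \<Sum>j\<in>UNIV. \<Sum>k\<in>UNIV. if j = i then B * ?D p i k else 0) = ?N\<^sup>2 * (2 * B * v)"
      unfolding 2[symmetric]
      by (rule sum.cong[OF refl], subst sum.swap, simp)
    have 4: "(\<Sum>i\<in>UNIV. \<Sum>j\<in>UNIV. \<Sum>k\<in>UNIV. if j = k then B * ?D p k i else 0) = ?N\<^sup>2 * (2 * B * v)"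
      unfolding 2[symmetric] by (subst (2) sum.swap) simp
    show "(\<Sum>i\<in>UNIV. \<Sum>j\<in>UNIV. \<Sum>k\<in>UNIV. ?T p i j k) = ?N\<^sup>2 * (4 * B * v + 2 * K * S)"
      unfolding sum.distrib 1 3 4 by (simp add: algebra_simps)
  qed
  also have "\<dots> = ?N * (real (card ?P) * (?N * (4 * B * v + 2 * K * S)))"
    by (simp add: power2_eq_square)
  finally show ?thesis by (simp only: abs_mult abs_of_nat) simp
qed

text \<open>Writing y_i as the mean over j of y_i - y_j and exchanging i and j replaces
  \<open>F i\<close> by half its increment. In the application the exchange moves \<open>y\<close>
  by a multiple of e_i - e_j, so the linear part of the increment is governed by
  \<open>H i i - H i j\<close>. The remainder is at most K |y_i - y_j|^3 per pair; summing over
  pairs and dividing by n gives 8 K S.\<close>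

lemma sum_perms_first_order:
  fixes F :: "'n \<Rightarrow> real ^ 'n \<Rightarrow> real" and H :: "'n \<Rightarrow> 'n \<Rightarrow> real ^ 'n \<Rightarrow> real"
  assumes F: "\<And>i j y. \<bar>F i y - F i (swap_vec i j y) - (y $ i - y $ j) * (H i i y - H i j y)\<bar>
      \<le> 2 * K * (y $ i - y $ j)\<^sup>2"
  shows "\<bar>\<Sum>p\<in>perms. (\<Sum>i\<in>UNIV. permute_vec p x $ i * F i (permute_vec p x)) -
      (\<Sum>i\<in>UNIV. \<Sum>j\<in>UNIV. (permute_vec p x $ i - permute_vec p x $ j)\<^sup>2 *
        (H i i (permute_vec p x) - H i j (permute_vec p x))) / (2 * real CARD('n))\<bar>
    \<le> real (card (perms :: ('n \<Rightarrow> 'n) set)) * (8 * K * S)"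
proof -
  let ?y = "\<lambda>p. permute_vec p x" and ?N = "real CARD('n)"
  let ?P = "perms :: ('n \<Rightarrow> 'n) set"
  let ?Q = "\<lambda>p i j. (?y p $ i - ?y p $ j)\<^sup>2 * (H i i (?y p) - H i j (?y p))"
  have "?N * (\<Sum>p\<in>?P. \<Sum>i\<in>UNIV. ?y p $ i * F i (?y p))
      = (\<Sum>p\<in>?P. \<Sum>i\<in>UNIV. \<Sum>j\<in>UNIV. (?y p $ i - ?y p $ j) * F i (?y p))"
    unfolding sum_distrib_left
    by (intro sum.cong refl)
       (simp add: sum_distrib_right[symmetric] sum_subtractf perms_sums del: permute_vec_nth)
  also have "\<dots> = (\<Sum>i\<in>UNIV. \<Sum>j\<in>UNIV. \<Sum>p\<in>?P. (?y p $ i - ?y p $ j) * F i (?y p))"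
    by (subst sum.swap, rule sum.cong[OF refl], rule sum.swap)
  finally have 1: "?N * (\<Sum>p\<in>?P. \<Sum>i\<in>UNIV. ?y p $ i * F i (?y p)) = \<dots>" .
  have 2: "(\<Sum>p\<in>?P. \<Sum>i\<in>UNIV. \<Sum>j\<in>UNIV. ?Q p i j) = (\<Sum>i\<in>UNIV. \<Sum>j\<in>UNIV. \<Sum>p\<in>?P. ?Q p i j)"
    by (subst sum.swap, rule sum.cong[OF refl], rule sum.swap)
  have "?N * (\<Sum>p\<in>?P. (\<Sum>i\<in>UNIV. ?y p $ i * F i (?y p)) - (\<Sum>i\<in>UNIV. \<Sum>j\<in>UNIV. ?Q p i j) / (2 * ?N))
    = ?N * (\<Sum>p\<in>?P. \<Sum>i\<in>UNIV. ?y p $ i * F i (?y p)) - (\<Sum>p\<in>?P. \<Sum>i\<in>UNIV. \<Sum>j\<in>UNIV. ?Q p i j) / 2"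
    by (simp only: sum_subtractf right_diff_distrib sum_divide_distrib[symmetric]) simp
  also have "\<dots> = (\<Sum>i\<in>UNIV. \<Sum>j\<in>UNIV. (\<Sum>p\<in>?P. (?y p $ i - ?y p $ j) * F i (?y p)) - (\<Sum>p\<in>?P. ?Q p i j) / 2)"
    unfolding 1 2 by (simp add: sum_subtractf sum_divide_distrib del: permute_vec_nth)
  finally have "\<bar>?N * (\<Sum>p\<in>?P. (\<Sum>i\<in>UNIV. ?y p $ i * F i (?y p)) - (\<Sum>i\<in>UNIV. \<Sum>j\<in>UNIV. ?Q p i j) / (2 * ?N))\<bar> = \<bar>\<dots>\<bar>" by (rule arg_cong)
  also have "\<dots> \<le> (\<Sum>i\<in>UNIV. \<Sum>j\<in>UNIV. \<Sum>p\<in>?P. K * (4 * (\<bar>?y p $ i\<bar> ^ 3 + \<bar>?y p $ j\<bar> ^ 3)))"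
  proof (rule order.trans[OF sum_abs], rule sum_mono, rule order.trans[OF sum_abs], rule sum_mono)
    fix i j :: 'n
    let ?R = "\<lambda>y. F i y - F i (swap_vec i j y) - (y $ i - y $ j) * (H i i y - H i j y)"
    have "(\<Sum>p\<in>?P. (?y p $ i - ?y p $ j) * F i (?y p)) - (\<Sum>p\<in>?P. ?Q p i j) / 2
      = (\<Sum>p\<in>?P. (?y p $ i - ?y p $ j) * (F i (?y p) - F i (swap_vec i j (?y p)))) / 2 - (\<Sum>p\<in>?P. ?Q p i j) / 2"
      by (subst sum_perms_antisym[of "\<lambda>y. y $ i - y $ j" i j]) auto
    also have "\<dots> = (\<Sum>p\<in>?P. (?y p $ i - ?y p $ j) * ?R (?y p) / 2)"
      unfolding diff_divide_distrib[symmetric] sum_subtractf[symmetric] sum_divide_distrib[symmetric]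
      by (intro arg_cong2[where f = "(/)"] sum.cong refl) (simp add: power2_eq_square algebra_simps del: permute_vec_nth)
    finally have "\<bar>(\<Sum>p\<in>?P. (?y p $ i - ?y p $ j) * F i (?y p)) - (\<Sum>p\<in>?P. ?Q p i j) / 2\<bar> = \<bar>\<dots>\<bar>" by (rule arg_cong)
    also have "\<dots> \<le> (\<Sum>p\<in>?P. K * (4 * (\<bar>?y p $ i\<bar> ^ 3 + \<bar>?y p $ j\<bar> ^ 3)))"
    proof (intro order.trans[OF sum_abs] sum_mono)
      fix p assume "p \<in> ?P"
      let ?d = "?y p $ i - ?y p $ j"
      have "\<bar>?d * ?R (?y p) / 2\<bar> = \<bar>?d\<bar> * \<bar>?R (?y p)\<bar> / 2" by (simp add: abs_mult del: permute_vec_nth)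
      also have "\<dots> \<le> \<bar>?d\<bar> * (2 * K * ?d\<^sup>2) / 2"
        by (intro divide_right_mono mult_left_mono F) auto
      also have "\<dots> = K * \<bar>?d\<bar> ^ 3" by (simp add: power3_eq_cube power2_eq_square del: permute_vec_nth)
      also have "\<dots> \<le> K * (4 * (\<bar>?y p $ i\<bar> ^ 3 + \<bar>?y p $ j\<bar> ^ 3))"
        by (intro mult_left_mono abs_diff_power3_le K_nonneg)
      finally show "\<bar>?d * ?R (?y p) / 2\<bar> \<le> K * (4 * (\<bar>?y p $ i\<bar> ^ 3 + \<bar>?y p $ j\<bar> ^ 3))" .
    qed
    finally show "\<bar>(\<Sum>p\<in>?P. (?y p $ i - ?y p $ j) * F i (?y p)) - (\<Sum>p\<in>?P. ?Q p i j) / 2\<bar>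
      \<le> (\<Sum>p\<in>?P. K * (4 * (\<bar>?y p $ i\<bar> ^ 3 + \<bar>?y p $ j\<bar> ^ 3)))" .
  qed
  also have "\<dots> = (\<Sum>p\<in>?P. \<Sum>i\<in>UNIV. \<Sum>j\<in>UNIV. K * (4 * (\<bar>?y p $ i\<bar> ^ 3 + \<bar>?y p $ j\<bar> ^ 3)))"
    by (rule sym, subst sum.swap, rule sum.cong[OF refl], rule sum.swap)
  also have "\<dots> = (\<Sum>p\<in>?P. ?N * (8 * K * S))"
    by (intro sum.cong refl)
       (simp only: mult.assoc[symmetric] double_sum_add perms_sums, simp)
  also have "\<dots> = ?N * (real (card ?P) * (8 * K * S))" by simp
  finally show ?thesis by (simp only: abs_mult abs_of_nat) simp
qed

text \<open>Everything rests on (a_i - a_j)^2 - 2 v = (a_i^2 - v) + (a_j^2 - v) - 2 a_i a_j. Against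
  \<open>H i i\<close> the sum over j can be carried out, and centering removes the product. Each
  term on the right has one of the shapes for which an exchange estimate is available above.\<close>

lemma second_order_decomposition:
  fixes a :: "real ^ 'n" and H :: "'n \<Rightarrow> 'n \<Rightarrow> real"
  assumes a1: "(\<Sum>i\<in>UNIV. a $ i) = 0" and a2: "(\<Sum>i\<in>UNIV. (a $ i)\<^sup>2) = real CARD('n) * v"
  shows "(\<Sum>i\<in>UNIV. \<Sum>j\<in>UNIV. (a $ i - a $ j)\<^sup>2 * (H i i - H i j)) / (2 * real CARD('n))
      - v / real CARD('n) * (\<Sum>i\<in>UNIV. \<Sum>j\<in>UNIV. H i i - H i j)
    = (\<Sum>i\<in>UNIV. ((a $ i)\<^sup>2 - v) * H i i) / 2
      - (\<Sum>j\<in>UNIV. \<Sum>i\<in>UNIV. ((a $ i)\<^sup>2 - v) * H i j) / (2 * real CARD('n))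
      - (\<Sum>i\<in>UNIV. \<Sum>j\<in>UNIV. ((a $ j)\<^sup>2 - v) * H i j) / (2 * real CARD('n))
      + (\<Sum>i\<in>UNIV. \<Sum>j\<in>UNIV. a $ i * a $ j * H i j) / real CARD('n)"
proof -
  let ?N = "real CARD('n)"
  define U where "U = (\<Sum>i\<in>UNIV. ((a $ i)\<^sup>2 - v) * H i i)"
  define V where "V = (\<Sum>j\<in>UNIV. \<Sum>i\<in>UNIV. ((a $ i)\<^sup>2 - v) * H i j)"
  define W where "W = (\<Sum>i\<in>UNIV. \<Sum>j\<in>UNIV. ((a $ j)\<^sup>2 - v) * H i j)"
  define Q where "Q = (\<Sum>i\<in>UNIV. \<Sum>j\<in>UNIV. a $ i * a $ j * H i j)"
  have diag: "(\<Sum>i\<in>UNIV. \<Sum>j\<in>UNIV. ((a $ i - a $ j)\<^sup>2 - 2 * v) * H i i)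
    = ?N * (\<Sum>i\<in>UNIV. ((a $ i)\<^sup>2 - v) * H i i)"
  proof -
    have "(\<Sum>j\<in>UNIV. (a $ i - a $ j)\<^sup>2 - 2 * v) = ?N * ((a $ i)\<^sup>2 - v)" for i
      by (simp add: power2_diff sum_subtractf sum.distrib a2 sum_distrib_left[symmetric] a1)
         (simp add: algebra_simps)
    then show ?thesis
      by (simp add: sum_distrib_right[symmetric] sum_distrib_left mult.assoc)
  qed
  have V: "(\<Sum>j\<in>UNIV. \<Sum>i\<in>UNIV. ((a $ i)\<^sup>2 - v) * H i j)
    = (\<Sum>i\<in>UNIV. \<Sum>j\<in>UNIV. ((a $ i)\<^sup>2 - v) * H i j)" by (rule sum.swap)
  \<comment> \<open>In the first of the three sums j is outermost, because the exchange estimate for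
    squares is applied for each fixed j.\<close>
  have offdiag: "(\<Sum>i\<in>UNIV. \<Sum>j\<in>UNIV. ((a $ i - a $ j)\<^sup>2 - 2 * v) * H i j)
    = (\<Sum>j\<in>UNIV. \<Sum>i\<in>UNIV. ((a $ i)\<^sup>2 - v) * H i j) + (\<Sum>i\<in>UNIV. \<Sum>j\<in>UNIV. ((a $ j)\<^sup>2 - v) * H i j)
      - 2 * (\<Sum>i\<in>UNIV. \<Sum>j\<in>UNIV. a $ i * a $ j * H i j)"
    unfolding V sum_distrib_left sum.distrib[symmetric] sum_subtractf[symmetric]
    by (intro sum.cong refl) (simp add: power2_diff algebra_simps)
  have "(\<Sum>i\<in>UNIV. \<Sum>j\<in>UNIV. (a $ i - a $ j)\<^sup>2 * (H i i - H i j)) - 2 * v * (\<Sum>i\<in>UNIV. \<Sum>j\<in>UNIV. H i i - H i j)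
    = (\<Sum>i\<in>UNIV. \<Sum>j\<in>UNIV. ((a $ i - a $ j)\<^sup>2 - 2 * v) * H i i) - (\<Sum>i\<in>UNIV. \<Sum>j\<in>UNIV. ((a $ i - a $ j)\<^sup>2 - 2 * v) * H i j)"
    unfolding sum_distrib_left sum_subtractf[symmetric]
    by (intro sum.cong refl) (simp add: algebra_simps)
  then have "(\<Sum>i\<in>UNIV. \<Sum>j\<in>UNIV. (a $ i - a $ j)\<^sup>2 * (H i i - H i j))
    = ?N * U + 2 * v * (\<Sum>i\<in>UNIV. \<Sum>j\<in>UNIV. H i i - H i j) - (V + W - 2 * Q)"
    unfolding diag offdiag U_def V_def W_def Q_def by linarith
  then show ?thesis
    unfolding U_def[symmetric] V_def[symmetric] W_def[symmetric] Q_def[symmetric]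
    by (simp only: diff_divide_distrib add_divide_distrib) simp
qed

text \<open>The subtracted term is what integration by parts gives exactly for a centered Gaussian
  vector with covariance v (\<delta>_ij - 1/n), \<open>H\<close> being the derivative of
  \<open>F\<close>. So the lemma says that a random permutation satisfies the Gaussian identity up
  to third-order errors and the coincidence term \<open>4 * B * v\<close>.\<close>

theorem permutation_integration_by_parts:
  fixes F :: "'n \<Rightarrow> real ^ 'n \<Rightarrow> real" and H :: "'n \<Rightarrow> 'n \<Rightarrow> real ^ 'n \<Rightarrow> real"
  assumes F: "\<And>i j y. \<bar>F i y - F i (swap_vec i j y) - (y $ i - y $ j) * (H i i y - H i j y)\<bar>
      \<le> 2 * K * (y $ i - y $ j)\<^sup>2"
    and H: "\<And>i j k l y. \<bar>H i j y - H i j (swap_vec k l y)\<bar> \<le> K * \<bar>y $ k - y $ l\<bar>"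
    and B: "\<And>i j y. \<bar>H i j y\<bar> \<le> B"
  shows "\<bar>\<Sum>p\<in>perms. (\<Sum>i\<in>UNIV. permute_vec p x $ i * F i (permute_vec p x)) -
      v / real CARD('n) * (\<Sum>i\<in>UNIV. \<Sum>j\<in>UNIV. H i i (permute_vec p x) - H i j (permute_vec p x))\<bar>
    \<le> real (card (perms :: ('n \<Rightarrow> 'n) set)) * (16 * K * S + 4 * B * v)"
proof -
  let ?y = "\<lambda>p. permute_vec p x" and ?N = "real CARD('n)"
  let ?P = "perms :: ('n \<Rightarrow> 'n) set"
  let ?c = "real (card ?P)"
  define T where "T = (\<Sum>p\<in>?P. (\<Sum>i\<in>UNIV. ?y p $ i * F i (?y p)) -
      (\<Sum>i\<in>UNIV. \<Sum>j\<in>UNIV. (?y p $ i - ?y p $ j)\<^sup>2 * (H i i (?y p) - H i j (?y p))) / (2 * ?N))"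
  define A where "A = (\<Sum>p\<in>?P. \<Sum>i\<in>UNIV. ((?y p $ i)\<^sup>2 - v) * H i i (?y p))"
  define C where "C j = (\<Sum>p\<in>?P. \<Sum>i\<in>UNIV. ((?y p $ i)\<^sup>2 - v) * H i j (?y p))" for j
  define D where "D i = (\<Sum>p\<in>?P. \<Sum>j\<in>UNIV. ((?y p $ j)\<^sup>2 - v) * H i j (?y p))" for i
  define E where "E = (\<Sum>p\<in>?P. \<Sum>i\<in>UNIV. \<Sum>j\<in>UNIV. ?y p $ i * ?y p $ j * H i j (?y p))"
  have "(\<Sum>p\<in>?P. (\<Sum>i\<in>UNIV. ?y p $ i * F i (?y p)) -
      v / ?N * (\<Sum>i\<in>UNIV. \<Sum>j\<in>UNIV. H i i (?y p) - H i j (?y p)))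
    = T + (\<Sum>p\<in>?P. (\<Sum>i\<in>UNIV. \<Sum>j\<in>UNIV. (?y p $ i - ?y p $ j)\<^sup>2 * (H i i (?y p) - H i j (?y p))) / (2 * ?N)
      - v / ?N * (\<Sum>i\<in>UNIV. \<Sum>j\<in>UNIV. H i i (?y p) - H i j (?y p)))"
    unfolding T_def sum.distrib[symmetric] by (intro sum.cong refl) simp
  also have "\<dots> = T + A / 2 - (\<Sum>j\<in>UNIV. C j) / (2 * ?N) - (\<Sum>i\<in>UNIV. D i) / (2 * ?N) + E / ?N"
  proof -
    have "(\<Sum>j\<in>UNIV. C j) = (\<Sum>p\<in>?P. \<Sum>j\<in>UNIV. \<Sum>i\<in>UNIV. ((?y p $ i)\<^sup>2 - v) * H i j (?y p))"
      "(\<Sum>i\<in>UNIV. D i) = (\<Sum>p\<in>?P. \<Sum>i\<in>UNIV. \<Sum>j\<in>UNIV. ((?y p $ j)\<^sup>2 - v) * H i j (?y p))"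
      unfolding C_def D_def by (rule sum.swap)+
    then show ?thesis
      using second_order_decomposition[OF perms_sums(1,2), of _ "\<lambda>i j. H i j (?y _)"]
      by (simp add: A_def E_def sum.distrib sum_subtractf sum_divide_distrib[symmetric] del: permute_vec_nth)
  qed
  finally have "\<bar>\<Sum>p\<in>?P. (\<Sum>i\<in>UNIV. ?y p $ i * F i (?y p)) -
      v / ?N * (\<Sum>i\<in>UNIV. \<Sum>j\<in>UNIV. H i i (?y p) - H i j (?y p))\<bar> = \<bar>\<dots>\<bar>" by (rule arg_cong)
  also have "\<dots> \<le> \<bar>T\<bar> + \<bar>A\<bar> / 2 + \<bar>\<Sum>j\<in>UNIV. C j\<bar> / (2 * ?N) + \<bar>\<Sum>i\<in>UNIV. D i\<bar> / (2 * ?N) + \<bar>E\<bar> / ?N"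
  proof -
    have tri: "\<bar>T + a - b - c + d\<bar> \<le> \<bar>T\<bar> + \<bar>a\<bar> + \<bar>b\<bar> + \<bar>c\<bar> + \<bar>d\<bar>" for a b c d :: real by linarith
    show ?thesis by (rule order.trans[OF tri]) (simp add: abs_divide)
  qed
  \<comment> \<open>The coefficient 16 of \<open>K * S\<close> is 8 from the Taylor remainder, 2
    from each of the three sums of centered squares, and 2 from the products.\<close>
  also have "\<dots> \<le> ?c * (8 * K * S) + ?c * (4 * K * S) / 2 + ?N * (?c * (4 * K * S)) / (2 * ?N)
      + ?N * (?c * (4 * K * S)) / (2 * ?N) + ?c * (?N * (4 * B * v + 2 * K * S)) / ?N"
  proof (intro add_mono divide_right_mono)
    show "\<bar>T\<bar> \<le> ?c * (8 * K * S)"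
      unfolding T_def by (rule sum_perms_first_order[OF F])
    show "\<bar>A\<bar> \<le> ?c * (4 * K * S)"
      unfolding A_def by (rule sum_perms_centered_square[of "\<lambda>i. H i i", OF H])
    have "\<bar>C j\<bar> \<le> ?c * (4 * K * S)" for j
      unfolding C_def by (rule sum_perms_centered_square[of "\<lambda>i. H i j", OF H])
    then have "\<bar>\<Sum>j\<in>UNIV. C j\<bar> \<le> (\<Sum>j\<in>(UNIV :: 'n set). ?c * (4 * K * S))"
      by (intro order.trans[OF sum_abs] sum_mono)
    then show "\<bar>\<Sum>j\<in>UNIV. C j\<bar> \<le> ?N * (?c * (4 * K * S))" by simp
    have "\<bar>D i\<bar> \<le> ?c * (4 * K * S)" for i
      unfolding D_def by (rule sum_perms_centered_square[of "\<lambda>j. H i j", OF H])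
    then have "\<bar>\<Sum>j\<in>UNIV. D j\<bar> \<le> (\<Sum>j\<in>(UNIV :: 'n set). ?c * (4 * K * S))"
      by (intro order.trans[OF sum_abs] sum_mono)
    then show "\<bar>\<Sum>j\<in>UNIV. D j\<bar> \<le> ?N * (?c * (4 * K * S))" by simp
    show "\<bar>E\<bar> \<le> ?c * (?N * (4 * B * v + 2 * K * S))"
      unfolding E_def by (rule sum_perms_products[OF H B])
  qed auto
  also have "\<dots> = ?c * (16 * K * S + 4 * B * v)" by (simp add: field_simps)
  finally show ?thesis .
qed

end

section \<open>Differentiation with respect to several variables\<close>

lemma cont_diff_continuous: "cont_diff k f \<Longrightarrow> continuous_on UNIV f"
  by (cases k) auto

lemma has_real_derivative_along_axis:
  assumes "\<And>x. partially_differentiable i f x"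
  shows "((\<lambda>t. f (x + t *\<^sub>R axis i 1)) has_real_derivative partial_deriv i f (x + t *\<^sub>R axis i 1)) (at t)"
proof -
  have "((\<lambda>s. f ((x + t *\<^sub>R axis i 1) + s *\<^sub>R axis i 1)) has_real_derivative
      partial_deriv i f (x + t *\<^sub>R axis i 1)) (at 0)"
    using assms unfolding partially_differentiable_def partial_deriv_def
    by (simp add: DERIV_deriv_iff_field_differentiable)
  then have "((\<lambda>s. f (x + (s + t) *\<^sub>R axis i 1)) has_real_derivative
      partial_deriv i f (x + t *\<^sub>R axis i 1)) (at 0)"
    by (simp add: algebra_simps)
  then show ?thesis
    using DERIV_shift[of "\<lambda>t. f (x + t *\<^sub>R axis i 1)" _ 0 t] by simp
qed

text \<open>The increment is built up one coordinate at a time. On each axis-parallel segment the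
  mean value inequality applies, and all intermediate points stay within distance
  \<open>norm (y - x)\<close> of \<open>x\<close>, where the partial derivatives are close to their
  values at \<open>x\<close>.\<close>

lemma has_derivative_continuous_partials:
  fixes f :: "real ^ 'n \<Rightarrow> real"
  assumes f: "cont_diff (Suc k) f"
  shows "(f has_derivative (\<lambda>h. \<Sum>i\<in>UNIV. partial_deriv i f x * h $ i)) (at x)"
  unfolding has_derivative_at_alt
proof (intro conjI allI impI)
  show "bounded_linear (\<lambda>h. \<Sum>i\<in>UNIV. partial_deriv i f x * h $ i)"
    by (intro bounded_linear_sum bounded_linear_const_mult bounded_linear_vec_nth)
next
  fix e :: real assume e: "0 < e"
  \<comment> \<open>The coordinatewise errors add up to \<epsilon> times the l1 norm of the
    increment, which is at most n times its Euclidean norm.\<close>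
  define \<epsilon> where "\<epsilon> = e / real CARD('n)"
  have \<epsilon>: "0 < \<epsilon>" using e by (simp add: \<epsilon>_def)
  have "\<forall>i. \<exists>d>0. \<forall>u. dist u x < d \<longrightarrow> dist (partial_deriv i f u) (partial_deriv i f x) < \<epsilon>"
  proof
    fix i
    have "continuous_on UNIV (partial_deriv i f)"
      using f by (auto intro: cont_diff_continuous)
    then show "\<exists>d>0. \<forall>u. dist u x < d \<longrightarrow> dist (partial_deriv i f u) (partial_deriv i f x) < \<epsilon>"
      using \<epsilon> by (auto simp: continuous_on_iff)
  qed
  then obtain d where d: "\<And>i. 0 < d i"
    "\<And>i u. dist u x < d i \<Longrightarrow> dist (partial_deriv i f u) (partial_deriv i f x) < \<epsilon>"
    by metis
  define \<delta> where "\<delta> = Min (range d)"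
  have \<delta>: "0 < \<delta>" "\<And>i. \<delta> \<le> d i" using d(1) by (auto simp: \<delta>_def)
  have close: "\<bar>partial_deriv i f u - partial_deriv i f x\<bar> \<le> \<epsilon>" if "norm (u - x) < \<delta>" for i u
    using d(2)[of u i] \<delta>(2)[of i] that by (simp add: dist_norm)
  show "\<exists>d>0. \<forall>y. norm (y - x) < d \<longrightarrow>
    norm (f y - f x - (\<Sum>i\<in>UNIV. partial_deriv i f x * (y - x) $ i)) \<le> e * norm (y - x)"
  proof (intro exI[of _ \<delta>] conjI allI impI \<delta>(1))
    fix y assume y: "norm (y - x) < \<delta>"
    define h where "h = y - x"
    define r where "r A = (\<chi> i. if i \<in> A then h $ i else 0)" for A
    have "\<bar>f (x + r A) - f x - (\<Sum>i\<in>A. partial_deriv i f x * h $ i)\<bar> \<le> \<epsilon> * (\<Sum>i\<in>A. \<bar>h $ i\<bar>)"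
      if "finite A" for A
      using that
    proof (induction A)
      case empty
      have "r {} = 0" by (simp add: r_def vec_eq_iff)
      then show ?case by simp
    next
      case (insert a A)
      let ?g = "\<lambda>t. f ((x + r A) + t *\<^sub>R axis a 1)"
      let ?c = "partial_deriv a f x"
      have r: "x + r (insert a A) = (x + r A) + (h $ a) *\<^sub>R axis a 1"
        using insert by (auto simp: r_def vec_eq_iff axis_def)
      have "norm ((?g (h $ a) - ?c * h $ a) - (?g 0 - ?c * 0)) \<le> \<epsilon> * norm (h $ a - 0)"
      proof (rule field_differentiable_bound[of "closed_segment 0 (h $ a)"])
        fix t assume t: "t \<in> closed_segment 0 (h $ a)"
        have "((\<lambda>t. ?g t - ?c * t) has_real_derivative
            partial_deriv a f ((x + r A) + t *\<^sub>R axis a 1) - ?c * 1) (at t)"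
          using f by (intro derivative_intros has_real_derivative_along_axis) auto
        then show "((\<lambda>t. ?g t - ?c * t) has_real_derivative
            partial_deriv a f ((x + r A) + t *\<^sub>R axis a 1) - ?c * 1) (at t within closed_segment 0 (h $ a))"
          by (rule has_field_derivative_at_within)
        have "\<bar>t\<bar> \<le> \<bar>h $ a\<bar>"
          using segment_bound1[OF t] by simp
        then have "norm (r A + t *\<^sub>R axis a 1) \<le> norm h"
          using insert by (intro norm_le_componentwise_cart) (auto simp: r_def axis_def)
        then show "norm (partial_deriv a f ((x + r A) + t *\<^sub>R axis a 1) - ?c * 1) \<le> \<epsilon>"
          using close[of "(x + r A) + t *\<^sub>R axis a 1" a] y by (simp add: h_def add.assoc)
      qed auto
      then have "\<bar>f (x + r (insert a A)) - f (x + r A) - ?c * h $ a\<bar> \<le> \<epsilon> * \<bar>h $ a\<bar>"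
        by (simp add: r algebra_simps)
      then show ?case using insert by (simp add: distrib_left)
    qed
    moreover have "x + r UNIV = y" by (simp add: r_def h_def vec_eq_iff)
    ultimately have "\<bar>f y - f x - (\<Sum>i\<in>UNIV. partial_deriv i f x * h $ i)\<bar> \<le> \<epsilon> * (\<Sum>i\<in>UNIV. \<bar>h $ i\<bar>)"
      by (metis finite)
    also have "\<dots> \<le> \<epsilon> * (\<Sum>i\<in>(UNIV :: 'n set). norm h)"
      using \<epsilon> by (intro mult_left_mono sum_mono component_le_norm_cart) auto
    also have "\<dots> = e * norm h" by (simp add: \<epsilon>_def)
    finally show "norm (f y - f x - (\<Sum>i\<in>UNIV. partial_deriv i f x * (y - x) $ i)) \<le> e * norm (y - x)"
      by (simp add: h_def)
  qed
qed

lemma has_real_derivative_line: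
  fixes f :: "real ^ 'n \<Rightarrow> real"
  assumes f: "(f has_derivative (\<lambda>h. \<Sum>i\<in>UNIV. D i * h $ i)) (at (g t))"
    and g: "(g has_vector_derivative w) (at t)"
  shows "((\<lambda>t. f (g t)) has_real_derivative (\<Sum>i\<in>UNIV. D i * w $ i)) (at t)"
proof -
  have "((\<lambda>t. f (g t)) has_derivative (\<lambda>s. \<Sum>i\<in>UNIV. D i * (s *\<^sub>R w) $ i)) (at t)"
    using has_derivative_compose[OF g[unfolded has_vector_derivative_def] f] .
  then show ?thesis
    unfolding has_field_derivative_def
    by (rule has_derivative_eq_rhs) (simp add: fun_eq_iff sum_distrib_left mult_ac)
qed

lemma mean_value_line:
  fixes f :: "real ^ 'n \<Rightarrow> real"
  assumes f: "\<And>x. (f has_derivative (\<lambda>h. \<Sum>i\<in>UNIV. D i x * h $ i)) (at x)"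
  obtains t where "0 < t" "t < 1"
    "f u - f v = (\<Sum>i\<in>UNIV. D i (v + t *\<^sub>R (u - v)) * (u $ i - v $ i))"
proof -
  have "((\<lambda>t. f (v + t *\<^sub>R (u - v))) has_real_derivative
      (\<Sum>i\<in>UNIV. D i (v + t *\<^sub>R (u - v)) * (u - v) $ i)) (at t)" for t
    by (rule has_real_derivative_line[OF f]) (auto intro!: derivative_eq_intros)
  from MVT2[OF zero_less_one this] show ?thesis
    using that by auto
qed

text \<open>The l1 norm suits bounds on individual partial derivatives: exchanging two coordinates
  alters only two entries, so no power of the dimension enters.\<close>

lemma l1_lipschitz:
  fixes f :: "real ^ 'n \<Rightarrow> real"
  assumes f: "\<And>x. (f has_derivative (\<lambda>h. \<Sum>i\<in>UNIV. D i x * h $ i)) (at x)"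
    and D: "\<And>i x. \<bar>D i x\<bar> \<le> L"
  shows "\<bar>f u - f v\<bar> \<le> L * (\<Sum>i\<in>UNIV. \<bar>u $ i - v $ i\<bar>)"
proof -
  obtain t where "f u - f v = (\<Sum>i\<in>UNIV. D i (v + t *\<^sub>R (u - v)) * (u $ i - v $ i))"
    using mean_value_line[OF f] by blast
  also have "\<bar>\<dots>\<bar> \<le> (\<Sum>i\<in>UNIV. L * \<bar>u $ i - v $ i\<bar>)"
    by (intro order.trans[OF sum_abs] sum_mono) (auto simp: abs_mult intro!: mult_right_mono D)
  finally show ?thesis by (simp add: sum_distrib_left)
qed

text \<open>A mean value point lies on the segment, hence no coordinate of it is farther from
  \<open>u\<close> than that of \<open>v\<close>. This gives \<open>L\<close> instead of the L/2 of
  the integral remainder. The expansion is around \<open>u\<close>, so that in the application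
  \<open>H\<close> is evaluated at the vector before the exchange.\<close>

lemma l1_taylor:
  fixes f :: "real ^ 'n \<Rightarrow> real"
  assumes f: "\<And>x. (f has_derivative (\<lambda>h. \<Sum>i\<in>UNIV. D i x * h $ i)) (at x)"
    and D: "\<And>i u v. \<bar>D i u - D i v\<bar> \<le> L * (\<Sum>k\<in>UNIV. \<bar>u $ k - v $ k\<bar>)" and L: "0 \<le> L"
  shows "\<bar>f u - f v - (\<Sum>i\<in>UNIV. D i u * (u $ i - v $ i))\<bar> \<le> L * (\<Sum>i\<in>UNIV. \<bar>u $ i - v $ i\<bar>)\<^sup>2"
proof -
  obtain t where t: "0 < t" "t < 1"
    and eq: "f u - f v = (\<Sum>i\<in>UNIV. D i (v + t *\<^sub>R (u - v)) * (u $ i - v $ i))"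
    using mean_value_line[OF f] by blast
  let ?S = "\<Sum>i\<in>UNIV. \<bar>u $ i - v $ i\<bar>"
  have D': "\<bar>D i (v + t *\<^sub>R (u - v)) - D i u\<bar> \<le> L * ?S" for i
  proof (rule order.trans[OF D], intro mult_left_mono sum_mono L)
    fix k
    have "(v + t *\<^sub>R (u - v)) $ k - u $ k = - (1 - t) * (u $ k - v $ k)" by (simp add: algebra_simps)
    then show "\<bar>(v + t *\<^sub>R (u - v)) $ k - u $ k\<bar> \<le> \<bar>u $ k - v $ k\<bar>"
      using t by (simp only: abs_mult) (auto intro!: mult_left_le_one_le)
  qed
  have "f u - f v - (\<Sum>i\<in>UNIV. D i u * (u $ i - v $ i))
      = (\<Sum>i\<in>UNIV. (D i (v + t *\<^sub>R (u - v)) - D i u) * (u $ i - v $ i))"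
    unfolding eq by (simp add: sum_subtractf left_diff_distrib)
  also have "\<bar>\<dots>\<bar> \<le> (\<Sum>i\<in>UNIV. (L * ?S) * \<bar>u $ i - v $ i\<bar>)"
    by (intro order.trans[OF sum_abs] sum_mono) (simp only: abs_mult, intro mult_right_mono D', simp)
  also have "\<dots> = L * ?S\<^sup>2" by (simp add: sum_distrib_left[symmetric] power2_eq_square)
  finally show ?thesis .
qed

section \<open>Gaussian integration by parts\<close>

lemma abs_le_of_bounded_derivative:
  fixes h h' :: "real \<Rightarrow> real"
  assumes "\<And>t. (h has_real_derivative h' t) (at t)" "\<And>t. \<bar>h' t\<bar> \<le> B"
  shows "\<bar>h t\<bar> \<le> \<bar>h 0\<bar> + B * \<bar>t\<bar>"
proof -
  have "norm (h t - h 0) \<le> B * norm (t - 0)"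
    by (rule field_differentiable_bound[of UNIV h h']) (use assms in auto)
  then show ?thesis by simp
qed

lemma std_normal_density_tendsto_0:
  fixes h :: "real \<Rightarrow> real"
  assumes h: "\<And>t. \<bar>h t\<bar> \<le> a + B * \<bar>t\<bar>"
  shows "((\<lambda>t. std_normal_density t * h t) \<longlongrightarrow> 0) at_top"
    and "((\<lambda>t. std_normal_density t * h t) \<longlongrightarrow> 0) at_bot"
proof -
  have *: "norm (std_normal_density t * h t) \<le> std_normal_density t * (a + B * \<bar>t\<bar>)" for t
    using mult_left_mono[OF h normal_density_nonneg] by (simp add: abs_mult)
  have "((\<lambda>t. std_normal_density t * (a + B * \<bar>t\<bar>)) \<longlongrightarrow> 0) at_top"
    unfolding std_normal_density_def by real_asymp
  then show "((\<lambda>t. std_normal_density t * h t) \<longlongrightarrow> 0) at_top"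
    by (rule Lim_null_comparison[rotated]) (use * in auto)
  have "((\<lambda>t. std_normal_density t * (a + B * \<bar>t\<bar>)) \<longlongrightarrow> 0) at_bot"
    unfolding std_normal_density_def by real_asymp
  then show "((\<lambda>t. std_normal_density t * h t) \<longlongrightarrow> 0) at_bot"
    by (rule Lim_null_comparison[rotated]) (use * in auto)
qed

text \<open>The density satisfies \<phi>'(t) = - t \<phi>(t), so the difference of the integrands is
  the derivative of \<phi> h. As \<open>h'\<close> is bounded, \<open>h\<close> grows at most
  linearly and \<phi> h vanishes at both ends.\<close>

lemma std_normal_integration_by_parts:
  fixes h h' :: "real \<Rightarrow> real"
  assumes h: "\<And>t. (h has_real_derivative h' t) (at t)" and h': "continuous_on UNIV h'" "\<And>t. \<bar>h' t\<bar> \<le> B"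
  shows "(\<integral>t. std_normal_density t * (t * h t) \<partial>lborel) = (\<integral>t. std_normal_density t * h' t \<partial>lborel)"
proof -
  let ?\<phi> = std_normal_density
  have hc: "continuous_on UNIV h"
    using h by (meson DERIV_isCont continuous_at_imp_continuous_on)
  have [measurable]: "h \<in> borel_measurable borel" "h' \<in> borel_measurable borel"
    using hc h'(1) by (auto intro: borel_measurable_continuous_onI)
  have hb: "\<bar>h t\<bar> \<le> \<bar>h 0\<bar> + B * \<bar>t\<bar>" for t by (rule abs_le_of_bounded_derivative[OF h h'(2)])
  have i1: "integrable lborel (\<lambda>t. ?\<phi> t * (t * h t))"
  proof (rule Bochner_Integration.integrable_bound)
    show "integrable lborel (\<lambda>t. \<bar>h 0\<bar> * (?\<phi> t * \<bar>t\<bar> ^ 1) + B * (?\<phi> t * \<bar>t\<bar> ^ 2))"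
      by (intro Bochner_Integration.integrable_add integrable_mult_right integrable_std_normal_moment_abs)
    show "AE t in lborel. norm (?\<phi> t * (t * h t)) \<le> norm (\<bar>h 0\<bar> * (?\<phi> t * \<bar>t\<bar> ^ 1) + B * (?\<phi> t * \<bar>t\<bar> ^ 2))"
    proof (intro always_eventually allI)
      fix t
      have "norm (?\<phi> t * (t * h t)) = ?\<phi> t * \<bar>t\<bar> * \<bar>h t\<bar>" by (simp add: abs_mult)
      also have "\<dots> \<le> ?\<phi> t * \<bar>t\<bar> * (\<bar>h 0\<bar> + B * \<bar>t\<bar>)" by (intro mult_left_mono hb) auto
      also have "\<dots> = \<bar>h 0\<bar> * (?\<phi> t * \<bar>t\<bar> ^ 1) + B * (?\<phi> t * \<bar>t\<bar> ^ 2)"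
        by (simp add: algebra_simps power2_eq_square)
      finally show "norm (?\<phi> t * (t * h t)) \<le> norm (\<bar>h 0\<bar> * (?\<phi> t * \<bar>t\<bar> ^ 1) + B * (?\<phi> t * \<bar>t\<bar> ^ 2))"
        by simp
    qed
  qed simp
  have i2: "integrable lborel (\<lambda>t. ?\<phi> t * h' t)"
  proof (rule Bochner_Integration.integrable_bound)
    show "integrable lborel (\<lambda>t. B * (?\<phi> t * \<bar>t\<bar> ^ 0))"
      by (intro integrable_mult_right integrable_std_normal_moment_abs)
    show "AE t in lborel. norm (?\<phi> t * h' t) \<le> norm (B * (?\<phi> t * \<bar>t\<bar> ^ 0))"
      using order.trans[OF h'(2) abs_ge_self]
      by (intro always_eventually allI) (simp add: abs_mult mult.commute mult_right_mono)
  qed simp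
  let ?f = "\<lambda>t. ?\<phi> t * h' t - ?\<phi> t * (t * h t)"
  have i: "integrable lborel ?f" using i1 i2 by simp
  have "((\<lambda>t. c * exp (- t\<^sup>2 / 2)) has_real_derivative - t * (c * exp (- t\<^sup>2 / 2))) (at t)" for c t :: real
    by (auto intro!: derivative_eq_intros)
  then have \<phi>': "(?\<phi> has_real_derivative - t * ?\<phi> t) (at t)" for t
    unfolding std_normal_density_def .
  have "(LBINT t=-\<infinity>..\<infinity>. ?f t) = 0 - 0"
  proof (rule interval_integral_FTC_integrable[where F = "\<lambda>t. ?\<phi> t * h t"])
    show "((\<lambda>t. ?\<phi> t * h t) has_vector_derivative ?f t) (at t)" for t
      unfolding has_real_derivative_iff_has_vector_derivative[symmetric]
      by (rule derivative_eq_intros \<phi>' h refl)+ (simp add: algebra_simps)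
    have "continuous_on UNIV ?f"
      unfolding std_normal_density_def by (intro continuous_intros hc h') auto
    then show "isCont ?f t" for t by (simp add: continuous_on_eq_continuous_at)
    show "set_integrable lborel (einterval (-\<infinity>) \<infinity>) ?f"
      using i by (simp add: set_integrable_def einterval_def)
    show "(((\<lambda>t. ?\<phi> t * h t) \<circ> real_of_ereal) \<longlongrightarrow> 0) (at_right (-\<infinity>))"
      "(((\<lambda>t. ?\<phi> t * h t) \<circ> real_of_ereal) \<longlongrightarrow> 0) (at_left \<infinity>)"
      using std_normal_density_tendsto_0[OF hb] by (simp_all add: ereal_tendsto_simps)
  qed simp
  then have "(\<integral>t. ?f t \<partial>lborel) = 0"
    by (simp add: interval_lebesgue_integral_def set_lebesgue_integral_def einterval_def)
  then show ?thesis using i1 i2 by simp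
qed

lemma borel_measurable_vecI:
  fixes g :: "'b \<Rightarrow> real ^ 'n"
  assumes "\<And>i. (\<lambda>x. g x $ i) \<in> borel_measurable N"
  shows "g \<in> borel_measurable N"
  using assms unfolding borel_measurable_euclidean_space[of g]
  by (auto simp: Basis_vec_def inner_axis)

lemma borel_measurable_vec_nth [measurable]:
  fixes g :: "'b \<Rightarrow> real ^ 'n"
  assumes "g \<in> borel_measurable N"
  shows "(\<lambda>x. g x $ i) \<in> borel_measurable N"
  using measurable_compose[OF assms, of "\<lambda>v. v $ i"]
  by (simp add: borel_measurable_continuous_onI continuous_on_component)

text \<open>The coordinate is embedded as a vector because \<open>indep_var\<close> requires both variables to have the same type.\<close>
lemma (in prob_space) standard_gaussian_indep_coordinate:
  fixes Z :: "'a \<Rightarrow> real ^ 'n"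
  assumes Z: "standard_gaussian M Z"
  shows "indep_var borel (\<lambda>\<omega>. Z \<omega> - (Z \<omega> $ i) *\<^sub>R axis i 1) borel (\<lambda>\<omega>. (Z \<omega> $ i) *\<^sub>R axis i 1)"
proof -
  let ?B = "\<lambda>_. borel :: real measure"
  have "indep_var (PiM (UNIV - {i}) ?B) (\<lambda>\<omega>. restrict (\<lambda>j. Z \<omega> $ j) (UNIV - {i}))
      (PiM {i} ?B) (\<lambda>\<omega>. restrict (\<lambda>j. Z \<omega> $ j) {i})"
    using Z unfolding standard_gaussian_def by (intro indep_var_restrict[where I = UNIV]) auto
  then have "indep_var borel ((\<lambda>y. \<chi> j. if j = i then 0 else y j) \<circ> (\<lambda>\<omega>. restrict (\<lambda>j. Z \<omega> $ j) (UNIV - {i})))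
      borel ((\<lambda>y. y i *\<^sub>R axis i 1) \<circ> (\<lambda>\<omega>. restrict (\<lambda>j. Z \<omega> $ j) {i}))"
  proof (rule indep_var_compose)
    show "(\<lambda>y. \<chi> j. if j = i then 0 else y j) \<in> borel_measurable (PiM (UNIV - {i}) ?B)"
    proof (rule borel_measurable_vecI)
      show "(\<lambda>y. (\<chi> j. if j = i then 0 else y j) $ k) \<in> borel_measurable (PiM (UNIV - {i}) ?B)" for k
        by (cases "k = i") (auto intro!: measurable_component_singleton)
    qed
    show "(\<lambda>y. y i *\<^sub>R axis i (1::real)) \<in> borel_measurable (PiM {i} ?B)"
      by (rule borel_measurable_scaleR) (auto intro!: measurable_component_singleton)
  qed
  moreover have "(\<lambda>y. \<chi> j. if j = i then 0 else y j) \<circ> (\<lambda>\<omega>. restrict (\<lambda>j. Z \<omega> $ j) (UNIV - {i}))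
      = (\<lambda>\<omega>. Z \<omega> - (Z \<omega> $ i) *\<^sub>R axis i 1)"
    by (auto simp: fun_eq_iff vec_eq_iff axis_def)
  moreover have "(\<lambda>y. y i *\<^sub>R axis i (1::real)) \<circ> (\<lambda>\<omega>. restrict (\<lambda>j. Z \<omega> $ j) {i}) = (\<lambda>\<omega>. (Z \<omega> $ i) *\<^sub>R axis i 1)"
    by (auto simp: fun_eq_iff)
  ultimately show ?thesis by simp
qed

text \<open>Under independence the joint law is a product, and this is Fubini's theorem. The inner
  expectation runs over a second sample point of the same space, so a value of \<open>X\<close> can
  be frozen without passing to distributions.\<close>

lemma (in prob_space) indep_var_expectation:
  fixes g :: "'b \<times> 'b \<Rightarrow> real"
  assumes XY: "indep_var S X T Y" and g: "g \<in> borel_measurable (S \<Otimes>\<^sub>M T)"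
    and int: "integrable M (\<lambda>\<omega>. g (X \<omega>, Y \<omega>))"
  shows "expectation (\<lambda>\<omega>. g (X \<omega>, Y \<omega>)) = expectation (\<lambda>\<omega>. expectation (\<lambda>\<omega>'. g (X \<omega>, Y \<omega>')))"
    and "integrable M (\<lambda>\<omega>. expectation (\<lambda>\<omega>'. g (X \<omega>, Y \<omega>')))"
proof -
  have X[measurable]: "X \<in> measurable M S" and [measurable]: "Y \<in> measurable M T"
    using XY by (auto dest: indep_var_rv1 indep_var_rv2)
  note g[measurable]
  interpret X: prob_space "distr M S X" by (rule prob_space_distr) simp
  interpret Y: prob_space "distr M T Y" by (rule prob_space_distr) simp
  interpret XY: pair_prob_space "distr M S X" "distr M T Y" ..
  have eq: "distr M S X \<Otimes>\<^sub>M distr M T Y = distr M (S \<Otimes>\<^sub>M T) (\<lambda>x. (X x, Y x))"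
    using XY by (simp add: indep_var_distribution_eq)
  have int': "integrable (distr M S X \<Otimes>\<^sub>M distr M T Y) g"
    unfolding eq using int by (subst integrable_distr_eq) auto
  have inner: "(\<integral>y. g (x, y) \<partial>distr M T Y) = expectation (\<lambda>\<omega>'. g (x, Y \<omega>'))" if "x \<in> space S" for x
    using that by (subst integral_distr) auto
  have [measurable]: "(\<lambda>x. \<integral>y. g (x, y) \<partial>distr M T Y) \<in> borel_measurable S"
  proof -
    have "(\<lambda>x. \<integral>y. g (x, y) \<partial>distr M T Y) \<in> borel_measurable (distr M S X)"
      by (rule Y.borel_measurable_lebesgue_integral) simp
    then show ?thesis by simp
  qed
  have "expectation (\<lambda>\<omega>. g (X \<omega>, Y \<omega>)) = integral\<^sup>L (distr M S X \<Otimes>\<^sub>M distr M T Y) g"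
    unfolding eq by (subst integral_distr) auto
  also have "\<dots> = (\<integral>x. (\<integral>y. g (x, y) \<partial>distr M T Y) \<partial>distr M S X)"
    using XY.integral_fst'[OF int'] by simp
  also have "\<dots> = expectation (\<lambda>\<omega>. (\<integral>y. g (X \<omega>, y) \<partial>distr M T Y))"
    by (subst integral_distr) auto
  also have "\<dots> = expectation (\<lambda>\<omega>. expectation (\<lambda>\<omega>'. g (X \<omega>, Y \<omega>')))"
    by (intro Bochner_Integration.integral_cong refl inner) (rule measurable_space[OF X])
  finally show "expectation (\<lambda>\<omega>. g (X \<omega>, Y \<omega>)) = expectation (\<lambda>\<omega>. expectation (\<lambda>\<omega>'. g (X \<omega>, Y \<omega>')))" .
  have "integrable (distr M S X) (\<lambda>x. \<integral>y. g (x, y) \<partial>distr M T Y)"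
    using XY.integrable_fst'[OF int'] by simp
  then have "integrable M (\<lambda>\<omega>. (\<integral>y. g (X \<omega>, y) \<partial>distr M T Y))"
    by (subst (asm) integrable_distr_eq) auto
  then show "integrable M (\<lambda>\<omega>. expectation (\<lambda>\<omega>'. g (X \<omega>, Y \<omega>')))"
    by (rule Bochner_Integration.integrable_cong[THEN iffD1, OF refl, rotated])
       (auto intro!: inner measurable_space[OF X])
qed

lemma (in prob_space) standard_gaussian_integrable:
  fixes Z :: "'a \<Rightarrow> real ^ 'n"
  assumes Z: "standard_gaussian M Z"
  shows "integrable M (\<lambda>\<omega>. (Z \<omega> $ i) ^ k)"
  using Z integrable_std_normal_moment[of k] distributed_integrable[of M lborel "\<lambda>\<omega>. Z \<omega> $ i" std_normal_density "\<lambda>t. t ^ k"]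
  by (auto simp: standard_gaussian_def)

text \<open>Coordinate i is independent of the rest of \<open>Z\<close>. Freezing the rest reduces
  the claim to the one-dimensional identity along the i-th axis.\<close>

lemma (in prob_space) gaussian_integration_by_parts:
  fixes Z :: "'a \<Rightarrow> real ^ 'n" and h h' :: "real ^ 'n \<Rightarrow> real"
  assumes Z: "standard_gaussian M Z" "Z \<in> borel_measurable M"
    and h: "\<And>z t. ((\<lambda>t. h (z + t *\<^sub>R axis i 1)) has_real_derivative h' (z + t *\<^sub>R axis i 1)) (at t)"
    and cont: "continuous_on UNIV h" "continuous_on UNIV h'"
    and bd: "\<And>z. \<bar>h z\<bar> \<le> C" "\<And>z. \<bar>h' z\<bar> \<le> B"
  shows "expectation (\<lambda>\<omega>. Z \<omega> $ i * h (Z \<omega>)) = expectation (\<lambda>\<omega>. h' (Z \<omega>))"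
    and "integrable M (\<lambda>\<omega>. Z \<omega> $ i * h (Z \<omega>))"
    and "integrable M (\<lambda>\<omega>. h' (Z \<omega>))"
proof -
  note Z(2)[measurable]
  have hm[measurable]: "h \<in> borel_measurable borel" "h' \<in> borel_measurable borel"
    using cont by (auto intro: borel_measurable_continuous_onI)
  let ?T = "\<lambda>\<omega>. Z \<omega> $ i" and ?W = "\<lambda>\<omega>. (Z \<omega> $ i) *\<^sub>R axis i (1::real)" and ?V = "\<lambda>\<omega>. Z \<omega> - (Z \<omega> $ i) *\<^sub>R axis i 1"
  have ind: "indep_var borel ?V borel ?W" by (rule standard_gaussian_indep_coordinate[OF Z(1)])
  have D: "distributed M lborel ?T std_normal_density"
    using Z(1) by (simp add: standard_gaussian_def)
  show i1: "integrable M (\<lambda>\<omega>. Z \<omega> $ i * h (Z \<omega>))"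
  proof (rule Bochner_Integration.integrable_bound)
    show "integrable M (\<lambda>\<omega>. C * \<bar>Z \<omega> $ i\<bar>)"
      using standard_gaussian_integrable[OF Z(1), of i 1] by auto
    show "AE \<omega> in M. norm (Z \<omega> $ i * h (Z \<omega>)) \<le> norm (C * \<bar>Z \<omega> $ i\<bar>)"
      using order.trans[OF bd(1) abs_ge_self]
      by (intro always_eventually allI) (simp add: abs_mult mult.commute mult_right_mono)
  qed simp
  show i2: "integrable M (\<lambda>\<omega>. h' (Z \<omega>))"
    by (rule integrable_const_bound[of _ B]) (use bd(2) in auto)
  have "expectation (\<lambda>\<omega>. Z \<omega> $ i * h (Z \<omega>)) =
      expectation (\<lambda>\<omega>. (\<lambda>(v, w). w $ i * h (v + w)) (?V \<omega>, ?W \<omega>))"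
    by simp
  also have "\<dots> = expectation (\<lambda>\<omega>. expectation (\<lambda>\<omega>'. (\<lambda>(v, w). w $ i * h (v + w)) (?V \<omega>, ?W \<omega>')))"
    by (rule indep_var_expectation(1)[OF ind]) (use i1 in auto)
  also have "\<dots> = expectation (\<lambda>\<omega>. expectation (\<lambda>\<omega>'. (\<lambda>(v, w). h' (v + w)) (?V \<omega>, ?W \<omega>')))"
  proof (rule Bochner_Integration.integral_cong[OF refl])
    fix \<omega>
    let ?v = "?V \<omega>"
    have "expectation (\<lambda>\<omega>'. ?T \<omega>' * h (?v + ?T \<omega>' *\<^sub>R axis i 1))
        = (\<integral>t. std_normal_density t * (t * h (?v + t *\<^sub>R axis i 1)) \<partial>lborel)"
      by (subst distributed_integral[OF D]) auto
    also have "\<dots> = (\<integral>t. std_normal_density t * h' (?v + t *\<^sub>R axis i 1) \<partial>lborel)"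
      by (rule std_normal_integration_by_parts[OF h _ bd(2)])
         (intro continuous_on_compose2[OF cont(2)] continuous_intros, auto)
    also have "\<dots> = expectation (\<lambda>\<omega>'. h' (?v + ?T \<omega>' *\<^sub>R axis i 1))"
      by (subst distributed_integral[OF D]) auto
    finally show "expectation (\<lambda>\<omega>'. (\<lambda>(v, w). w $ i * h (v + w)) (?v, ?W \<omega>'))
      = expectation (\<lambda>\<omega>'. (\<lambda>(v, w). h' (v + w)) (?v, ?W \<omega>'))" by simp
  qed
  also have "\<dots> = expectation (\<lambda>\<omega>. (\<lambda>(v, w). h' (v + w)) (?V \<omega>, ?W \<omega>))"
    by (rule indep_var_expectation(1)[OF ind, symmetric]) (use i2 in auto)
  also have "\<dots> = expectation (\<lambda>\<omega>. h' (Z \<omega>))" by simp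
  finally show "expectation (\<lambda>\<omega>. Z \<omega> $ i * h (Z \<omega>)) = expectation (\<lambda>\<omega>. h' (Z \<omega>))" .
qed

section \<open>Interpolation\<close>

text \<open>By the mean value inequality the difference quotients inherit the majorant
  \<open>b\<close> of the derivatives, so dominated convergence applies along every sequence tending
  to \<open>t\<close>.\<close>

lemma (in prob_space) has_real_derivative_expectation:
  fixes g g' :: "real \<Rightarrow> 'a \<Rightarrow> real"
  assumes g: "\<And>t \<omega>. ((\<lambda>t. g t \<omega>) has_real_derivative g' t \<omega>) (at t)"
    and int: "\<And>t. integrable M (g t)" and meas: "\<And>t. g' t \<in> borel_measurable M"
    and bd: "\<And>t \<omega>. \<bar>g' t \<omega>\<bar> \<le> b \<omega>" and b: "integrable M b"
  shows "((\<lambda>t. expectation (g t)) has_real_derivative expectation (g' t)) (at t)"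
  unfolding has_field_derivative_iff tendsto_at_iff_sequentially
proof (intro allI impI)
  fix X :: "nat \<Rightarrow> real" assume X: "\<forall>i. X i \<in> UNIV - {t}" "X \<longlonglongrightarrow> t"
  have "(\<lambda>n. expectation (\<lambda>\<omega>. (g (X n) \<omega> - g t \<omega>) / (X n - t))) \<longlonglongrightarrow> expectation (g' t)"
  proof (rule integral_dominated_convergence[OF meas _ b])
    show "(\<lambda>\<omega>. (g (X n) \<omega> - g t \<omega>) / (X n - t)) \<in> borel_measurable M" for n
      using int by (intro borel_measurable_divide borel_measurable_diff borel_measurable_integrable) auto
    show "AE \<omega> in M. (\<lambda>n. (g (X n) \<omega> - g t \<omega>) / (X n - t)) \<longlonglongrightarrow> g' t \<omega>"
    proof (intro always_eventually allI)
      fix \<omega>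
      have "((\<lambda>y. (g y \<omega> - g t \<omega>) / (y - t)) \<longlongrightarrow> g' t \<omega>) (at t)"
        using g[of \<omega> t] by (simp add: has_field_derivative_iff)
      then show "(\<lambda>n. (g (X n) \<omega> - g t \<omega>) / (X n - t)) \<longlonglongrightarrow> g' t \<omega>"
        using X by (auto simp: tendsto_at_iff_sequentially o_def)
    qed
    show "AE \<omega> in M. norm ((g (X n) \<omega> - g t \<omega>) / (X n - t)) \<le> b \<omega>" for n
    proof (intro always_eventually allI)
      fix \<omega>
      have "norm (g (X n) \<omega> - g t \<omega>) \<le> b \<omega> * norm (X n - t)"
        by (rule field_differentiable_bound[of UNIV "\<lambda>t. g t \<omega>" "\<lambda>t. g' t \<omega>"]) (use g bd in auto)
      then show "norm ((g (X n) \<omega> - g t \<omega>) / (X n - t)) \<le> b \<omega>"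
        using X(1) by (simp add: field_simps)
    qed
  qed
  then show "((\<lambda>y. (expectation (g y) - expectation (g t)) / (y - t)) \<circ> X) \<longlonglongrightarrow> expectation (g' t)"
    using int by (simp add: o_def)
qed

text \<open>With this notation \<open>Y = (\<chi> i. emp_mean X) + emp_sd X *\<^sub>R center Z\<close>.\<close>
definition center :: "real ^ 'n \<Rightarrow> real ^ 'n" where
  "center z = (\<chi> i. z $ i - emp_mean z)"

lemma center_nth [simp]: "center z $ i = z $ i - emp_mean z"
  by (simp add: center_def)

lemma continuous_on_emp_mean [continuous_intros]:
  "continuous_on S g \<Longrightarrow> continuous_on S (\<lambda>x. emp_mean (g x))"
  unfolding emp_mean_def by (intro continuous_intros)

lemma continuous_on_center [continuous_intros]:
  "continuous_on S g \<Longrightarrow> continuous_on S (\<lambda>x. center (g x))"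
  unfolding center_def by (intro continuous_intros)

lemma borel_measurable_center [measurable]: "center \<in> borel_measurable borel"
  by (intro borel_measurable_continuous_onI continuous_intros)

text \<open>The direction is the j-th column of the orthogonal projection onto vectors of sum zero;
  its entries \<delta>_jk - 1/n are the covariances of the centered Gaussian vector.\<close>

lemma center_add_axis:
  fixes z :: "real ^ 'n"
  shows "center (z + t *\<^sub>R axis j 1) = center z + t *\<^sub>R (\<chi> k. (if k = j then 1 else 0) - 1 / real CARD('n))"
proof -
  have "(\<Sum>i\<in>UNIV. t * axis j 1 $ i) = t"
    by (simp add: axis_def if_distrib[of "(*) t"] cong: if_cong)
  then show ?thesis
    by (simp add: vec_eq_iff emp_mean_def sum.distrib axis_def algebra_simps add_divide_distrib)
qed

text \<open>Derivatives are parameters, and third derivatives enter only through the l1 Lipschitz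
  constant \<open>L3\<close> of \<open>f2\<close>. The bound \<open>L1\<close> supplies
  integrability and domination; it does not occur in the final estimate.\<close>

locale smooth_function =
  fixes f :: "real ^ 'n \<Rightarrow> real" and f1 :: "'n \<Rightarrow> real ^ 'n \<Rightarrow> real"
    and f2 :: "'n \<Rightarrow> 'n \<Rightarrow> real ^ 'n \<Rightarrow> real" and L1 L2 L3 :: real
  assumes f_deriv: "\<And>x. (f has_derivative (\<lambda>h. \<Sum>i\<in>UNIV. f1 i x * h $ i)) (at x)"
    and f1_deriv: "\<And>i x. (f1 i has_derivative (\<lambda>h. \<Sum>j\<in>UNIV. f2 i j x * h $ j)) (at x)"
    and f1_bound: "\<And>i x. \<bar>f1 i x\<bar> \<le> L1"
    and f2_bound: "\<And>i j x. \<bar>f2 i j x\<bar> \<le> L2"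
    and f2_lipschitz: "\<And>i j u v. \<bar>f2 i j u - f2 i j v\<bar> \<le> L3 * (\<Sum>k\<in>UNIV. \<bar>u $ k - v $ k\<bar>)"
    and f2_cont: "\<And>i j. continuous_on UNIV (f2 i j)"
    and L3_nonneg: "0 \<le> L3"
begin

lemma f_cont: "continuous_on UNIV f"
  using f_deriv by (meson continuous_at_imp_continuous_on has_derivative_continuous)

lemma f1_cont: "continuous_on UNIV (f1 i)"
  using f1_deriv by (meson continuous_at_imp_continuous_on has_derivative_continuous)

lemma f_measurable [measurable]: "f \<in> borel_measurable borel"
  by (rule borel_measurable_continuous_onI[OF f_cont])

lemma f1_measurable [measurable]: "f1 i \<in> borel_measurable borel"
  by (rule borel_measurable_continuous_onI[OF f1_cont])

lemma f2_measurable [measurable]: "f2 i j \<in> borel_measurable borel"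
  by (rule borel_measurable_continuous_onI[OF f2_cont])

lemma L1_nonneg: "0 \<le> L1"
  using f1_bound[of undefined undefined] by linarith

lemma L2_nonneg: "0 \<le> L2"
  using f2_bound[of undefined undefined undefined] by linarith

lemma f_growth: "\<bar>f u\<bar> \<le> \<bar>f 0\<bar> + L1 * (\<Sum>i\<in>UNIV. \<bar>u $ i\<bar>)"
  using l1_lipschitz[OF f_deriv f1_bound, of u 0] by simp

lemma swap_estimates:
  fixes c :: "real ^ 'n"
  assumes s: "0 \<le> s"
  shows "\<bar>f1 i (c + s *\<^sub>R y) - f1 i (c + s *\<^sub>R swap_vec i j y)
      - (y $ i - y $ j) * (s * f2 i i (c + s *\<^sub>R y) - s * f2 i j (c + s *\<^sub>R y))\<bar>
      \<le> 2 * (2 * s\<^sup>2 * L3) * (y $ i - y $ j)\<^sup>2" (is ?A)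
    and "\<bar>s * f2 i j (c + s *\<^sub>R y) - s * f2 i j (c + s *\<^sub>R swap_vec k l y)\<bar> \<le> 2 * s\<^sup>2 * L3 * \<bar>y $ k - y $ l\<bar>" (is ?B)
    and "\<bar>s * f2 i j (c + s *\<^sub>R y)\<bar> \<le> s * L2" (is ?C)
proof -
  have diff: "(c + s *\<^sub>R y) $ m - (c + s *\<^sub>R swap_vec k l y) $ m
      = s * (y $ k - y $ l) * (axis k 1 $ m - axis l 1 $ m)" for k l m
    by (auto simp: axis_def Transposition.transpose_def algebra_simps)
  have sum_le: "(\<Sum>m\<in>UNIV. \<bar>(c + s *\<^sub>R y) $ m - (c + s *\<^sub>R swap_vec k l y) $ m\<bar>) \<le> 2 * s * \<bar>y $ k - y $ l\<bar>" for k l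
  proof -
    have "(\<Sum>m\<in>(UNIV::'n set). \<bar>axis k 1 $ m - axis l 1 $ m :: real\<bar>)
        \<le> (\<Sum>m\<in>(UNIV::'n set). (if m = k then 1 else 0) + (if m = l then 1 else 0))"
      by (intro sum_mono) (auto simp: axis_def)
    also have "\<dots> = 2" by (simp add: sum.distrib)
    finally have "s * \<bar>y $ k - y $ l\<bar> * (\<Sum>m\<in>(UNIV::'n set). \<bar>axis k 1 $ m - axis l 1 $ m\<bar>) \<le> s * \<bar>y $ k - y $ l\<bar> * 2"
      using s by (intro mult_left_mono) auto
    then show ?thesis
      unfolding diff abs_mult sum_distrib_left[symmetric] using s by (simp add: mult_ac)
  qed
  have lin: "(\<Sum>m\<in>UNIV. f2 i m u * (s * (y $ i - y $ j) * (axis i 1 $ m - axis j 1 $ m)))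
      = (y $ i - y $ j) * (s * f2 i i u - s * f2 i j u)" for u
    by (simp add: axis_def algebra_simps sum_subtractf sum.distrib if_distrib[of "(*) _"] cong: if_cong)
  have "\<bar>f1 i (c + s *\<^sub>R y) - f1 i (c + s *\<^sub>R swap_vec i j y)
      - (y $ i - y $ j) * (s * f2 i i (c + s *\<^sub>R y) - s * f2 i j (c + s *\<^sub>R y))\<bar>
      \<le> L3 * (\<Sum>m\<in>UNIV. \<bar>(c + s *\<^sub>R y) $ m - (c + s *\<^sub>R swap_vec i j y) $ m\<bar>)\<^sup>2"
    using l1_taylor[OF f1_deriv f2_lipschitz L3_nonneg, of i "c + s *\<^sub>R y" "c + s *\<^sub>R swap_vec i j y"]
    unfolding diff lin .
  also have "\<dots> \<le> L3 * (2 * s * \<bar>y $ i - y $ j\<bar>)\<^sup>2"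
    by (intro mult_left_mono power_mono sum_le L3_nonneg sum_nonneg) auto
  also have "\<dots> = 2 * (2 * s\<^sup>2 * L3) * (y $ i - y $ j)\<^sup>2" by (simp add: power_mult_distrib)
  finally show ?A .
  have "\<bar>s * f2 i j (c + s *\<^sub>R y) - s * f2 i j (c + s *\<^sub>R swap_vec k l y)\<bar>
      = s * \<bar>f2 i j (c + s *\<^sub>R y) - f2 i j (c + s *\<^sub>R swap_vec k l y)\<bar>"
    using s by (simp add: right_diff_distrib[symmetric] abs_mult)
  also have "\<dots> \<le> s * (L3 * (2 * s * \<bar>y $ k - y $ l\<bar>))"
    by (intro mult_left_mono order.trans[OF f2_lipschitz] sum_le L3_nonneg s)
  also have "\<dots> = 2 * s\<^sup>2 * L3 * \<bar>y $ k - y $ l\<bar>" by (simp add: power2_eq_square)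
  finally show ?B .
  show ?C using s f2_bound by (simp add: abs_mult mult_left_mono)
qed

end

lemma (in prob_space) integrable_f:
  fixes V :: "'a \<Rightarrow> real ^ 'n"
  assumes "smooth_function f f1 f2 L1 L2 L3"
    and [measurable]: "V \<in> borel_measurable M" and V: "\<And>i. integrable M (\<lambda>\<omega>. V \<omega> $ i)"
  shows "integrable M (\<lambda>\<omega>. f (V \<omega>))"
proof -
  interpret smooth_function f f1 f2 L1 L2 L3 by fact
  show ?thesis
  proof (rule Bochner_Integration.integrable_bound)
    show "integrable M (\<lambda>\<omega>. \<bar>f 0\<bar> + L1 * (\<Sum>i\<in>UNIV. \<bar>V \<omega> $ i\<bar>))"
      using V by (intro Bochner_Integration.integrable_add integrable_mult_right
          Bochner_Integration.integrable_sum integrable_abs) auto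
    show "AE \<omega> in M. norm (f (V \<omega>)) \<le> norm (\<bar>f 0\<bar> + L1 * (\<Sum>i\<in>UNIV. \<bar>V \<omega> $ i\<bar>))"
      using order.trans[OF f_growth abs_ge_self] by (intro always_eventually allI) simp
  qed simp
qed

text \<open>Since the components of \<open>center z\<close> sum to zero, the cross terms produced by the sample mean cancel.\<close>
lemma (in prob_space) gaussian_center_integration_by_parts:
  fixes Z :: "'a \<Rightarrow> real ^ 'n"
  assumes "smooth_function f f1 f2 L1 L2 L3"
    and Z: "standard_gaussian M Z" "Z \<in> borel_measurable M"
  shows "expectation (\<lambda>\<omega>. center (Z \<omega>) $ i * f1 i (a + c *\<^sub>R center (Z \<omega>)))
      = c / real CARD('n) * expectation (\<lambda>\<omega>. \<Sum>k\<in>UNIV. f2 i i (a + c *\<^sub>R center (Z \<omega>)) - f2 i k (a + c *\<^sub>R center (Z \<omega>)))"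
    and "integrable M (\<lambda>\<omega>. center (Z \<omega>) $ i * f1 i (a + c *\<^sub>R center (Z \<omega>)))"
proof -
  interpret smooth_function f f1 f2 L1 L2 L3 by fact
  note Z(2)[measurable]
  let ?N = "real CARD('n)"
  define h where "h z = f1 i (a + c *\<^sub>R center z)" for z
  define w :: "'n \<Rightarrow> real ^ 'n" where "w j = (\<chi> k. (if k = j then 1 else 0) - 1 / ?N)" for j
  define h' where "h' j z = (\<Sum>k\<in>UNIV. f2 i k (a + c *\<^sub>R center z) * (c *\<^sub>R w j) $ k)" for j z
  have der: "((\<lambda>t. h (z + t *\<^sub>R axis j 1)) has_real_derivative h' j (z + t *\<^sub>R axis j 1)) (at t)" for z t j
    unfolding h_def h'_def
  proof (rule has_real_derivative_line[OF f1_deriv])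
    show "((\<lambda>t. a + c *\<^sub>R center (z + t *\<^sub>R axis j 1)) has_vector_derivative c *\<^sub>R w j) (at t)"
      unfolding center_add_axis w_def[symmetric] by (auto intro!: derivative_eq_intros)
  qed
  have cont: "continuous_on UNIV h" "continuous_on UNIV (h' j)" for j
    unfolding h_def h'_def
    by (intro continuous_intros continuous_on_compose2[OF f1_cont] continuous_on_compose2[OF f2_cont]; simp)+
  have bd: "\<bar>h z\<bar> \<le> L1" for z unfolding h_def by (rule f1_bound)
  have bd': "\<bar>h' j z\<bar> \<le> (\<Sum>k\<in>UNIV. L2 * \<bar>(c *\<^sub>R w j) $ k\<bar>)" for j z
    unfolding h'_def by (intro order.trans[OF sum_abs] sum_mono, simp only: abs_mult)
       (intro mult_right_mono f2_bound, simp)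
  note ibp = gaussian_integration_by_parts[OF Z der cont bd bd']
  have eq: "center (Z \<omega>) $ i * f1 i (a + c *\<^sub>R center (Z \<omega>))
      = Z \<omega> $ i * h (Z \<omega>) - 1 / ?N * (\<Sum>j\<in>UNIV. Z \<omega> $ j * h (Z \<omega>))" for \<omega>
    by (simp add: h_def emp_mean_def sum_distrib_right[symmetric] algebra_simps)
  show "integrable M (\<lambda>\<omega>. center (Z \<omega>) $ i * f1 i (a + c *\<^sub>R center (Z \<omega>)))"
    unfolding eq by (intro Bochner_Integration.integrable_diff integrable_mult_right
        Bochner_Integration.integrable_sum ibp(2))
  have sum0: "(\<Sum>j\<in>UNIV. h' j z) = 0" for z
  proof -
    have "(\<Sum>j\<in>UNIV. w j $ k) = 0" for k by (simp add: w_def sum_subtractf)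
    then show ?thesis
      unfolding h'_def by (subst sum.swap) (simp add: sum_distrib_left[symmetric])
  qed
  have "expectation (\<lambda>\<omega>. center (Z \<omega>) $ i * f1 i (a + c *\<^sub>R center (Z \<omega>)))
      = expectation (\<lambda>\<omega>. Z \<omega> $ i * h (Z \<omega>)) - 1 / ?N * (\<Sum>j\<in>UNIV. expectation (\<lambda>\<omega>. Z \<omega> $ j * h (Z \<omega>)))"
    unfolding eq using ibp(2) by simp
  also have "\<dots> = expectation (\<lambda>\<omega>. h' i (Z \<omega>)) - 1 / ?N * expectation (\<lambda>\<omega>. \<Sum>j\<in>UNIV. h' j (Z \<omega>))"
    using ibp(1,3) by simp
  also have "\<dots> = expectation (\<lambda>\<omega>. h' i (Z \<omega>))" by (simp add: sum0)
  also have "\<dots> = expectation (\<lambda>\<omega>. c / ?N * (\<Sum>k\<in>UNIV. f2 i i (a + c *\<^sub>R center (Z \<omega>)) - f2 i k (a + c *\<^sub>R center (Z \<omega>))))"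
  proof (intro Bochner_Integration.integral_cong refl)
    fix \<omega>
    show "h' i (Z \<omega>) = c / ?N * (\<Sum>k\<in>UNIV. f2 i i (a + c *\<^sub>R center (Z \<omega>)) - f2 i k (a + c *\<^sub>R center (Z \<omega>)))"
      unfolding h'_def w_def
      by (simp add: right_diff_distrib sum_subtractf if_distrib[of "(*) _"] sum_divide_distrib[symmetric]
          sum_distrib_left sum_distrib_right cong: if_cong) (simp add: field_simps sum_divide_distrib sum_distrib_left)
  qed
  also have "\<dots> = c / ?N * expectation (\<lambda>\<omega>. \<Sum>k\<in>UNIV. f2 i i (a + c *\<^sub>R center (Z \<omega>)) - f2 i k (a + c *\<^sub>R center (Z \<omega>)))"
    by simp
  finally show "expectation (\<lambda>\<omega>. center (Z \<omega>) $ i * f1 i (a + c *\<^sub>R center (Z \<omega>)))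
      = c / ?N * expectation (\<lambda>\<omega>. \<Sum>k\<in>UNIV. f2 i i (a + c *\<^sub>R center (Z \<omega>)) - f2 i k (a + c *\<^sub>R center (Z \<omega>)))" .
qed

text \<open>Both \<Psi> - \<Phi> and \<Psi> + \<Phi> are nondecreasing. In this form the derivative
  of the interpolation never has to be integrated.\<close>

lemma abs_diff_le_of_derivative_bound:
  fixes \<Phi> \<Psi> :: "real \<Rightarrow> real"
  assumes "a \<le> b"
    and \<Phi>: "\<And>t. (\<Phi> has_real_derivative \<Phi>' t) (at t)" and \<Psi>: "\<And>t. (\<Psi> has_real_derivative \<Psi>' t) (at t)"
    and bound: "\<And>t. a \<le> t \<Longrightarrow> t \<le> b \<Longrightarrow> \<bar>\<Phi>' t\<bar> \<le> \<Psi>' t"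
  shows "\<bar>\<Phi> b - \<Phi> a\<bar> \<le> \<Psi> b - \<Psi> a"
proof -
  have "\<Psi> a - \<Phi> a \<le> \<Psi> b - \<Phi> b"
  proof (rule DERIV_nonneg_imp_nondecreasing[OF \<open>a \<le> b\<close>])
    fix t assume "a \<le> t" "t \<le> b"
    then show "\<exists>y. ((\<lambda>t. \<Psi> t - \<Phi> t) has_real_derivative y) (at t) \<and> 0 \<le> y"
      using DERIV_diff[OF \<Psi> \<Phi>] bound[of t] by (intro exI[of _ "\<Psi>' t - \<Phi>' t"]) auto
  qed
  moreover have "\<Psi> a + \<Phi> a \<le> \<Psi> b + \<Phi> b"
  proof (rule DERIV_nonneg_imp_nondecreasing[OF \<open>a \<le> b\<close>])
    fix t assume "a \<le> t" "t \<le> b"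
    then show "\<exists>y. ((\<lambda>t. \<Psi> t + \<Phi> t) has_real_derivative y) (at t) \<and> 0 \<le> y"
      using DERIV_add[OF \<Psi> \<Phi>] bound[of t] by (intro exI[of _ "\<Psi>' t + \<Phi>' t"]) auto
  qed
  ultimately show ?thesis by linarith
qed

text \<open>At \<theta> = pi/2 the interpolation is a pure permutation and at \<theta> = 0 purely
  Gaussian. Its derivative is computed for each permutation under the expectation, but estimated for
  each \<open>\<omega>\<close> after summing over permutations.\<close>

lemma (in prob_space) permutation_gaussian_comparison:
  fixes Z :: "'a \<Rightarrow> real ^ 'n" and x :: "real ^ 'n"
  assumes smooth: "smooth_function f f1 f2 L1 L2 L3"
    and Z: "standard_gaussian M Z" "Z \<in> borel_measurable M"
    and sum_zero: "(\<Sum>i\<in>UNIV. x $ i) = 0"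
    and sum_squares: "(\<Sum>i\<in>UNIV. (x $ i)\<^sup>2) = real CARD('n) * v"
    and sum_cubes: "(\<Sum>i\<in>UNIV. \<bar>x $ i\<bar> ^ 3) = S"
  shows "\<bar>(\<Sum>p\<in>perms. f (a + permute_vec p x))
      - real (card (perms :: ('n \<Rightarrow> 'n) set)) * expectation (\<lambda>\<omega>. f (a + sqrt v *\<^sub>R center (Z \<omega>)))\<bar>
    \<le> real (card (perms :: ('n \<Rightarrow> 'n) set)) * (32 / 3 * L3 * S + 2 * L2 * v)"
proof -
  interpret smooth_function f f1 f2 L1 L2 L3 by fact
  note Z(2)[measurable]
  let ?N = "real CARD('n)" and ?P = "perms :: ('n \<Rightarrow> 'n) set"
  let ?c = "real (card ?P)"
  have "0 \<le> ?N * v" unfolding sum_squares[symmetric] by (intro sum_nonneg) simp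
  then have v: "0 \<le> v" by (simp add: zero_le_mult_iff)
  have intC: "integrable M (\<lambda>\<omega>. center (Z \<omega>) $ i)" for i
    unfolding center_nth emp_mean_def
    using standard_gaussian_integrable[OF Z(1), of _ 1]
    by (intro Bochner_Integration.integrable_diff integrable_mult_right Bochner_Integration.integrable_sum) simp_all
  define W where "W p \<theta> \<omega> = (a + sin \<theta> *\<^sub>R permute_vec p x) + (cos \<theta> * sqrt v) *\<^sub>R center (Z \<omega>)" for p \<theta> \<omega>
  define g where "g p \<theta> \<omega> = f (W p \<theta> \<omega>)" for p \<theta> \<omega>
  define g' where "g' p \<theta> \<omega> = (\<Sum>i\<in>UNIV. f1 i (W p \<theta> \<omega>) *
      (cos \<theta> *\<^sub>R permute_vec p x - (sin \<theta> * sqrt v) *\<^sub>R center (Z \<omega>)) $ i)" for p \<theta> \<omega>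
  have [measurable]: "W p \<theta> \<in> borel_measurable M" for p \<theta>
    unfolding W_def by measurable
  have intW: "integrable M (\<lambda>\<omega>. W p \<theta> \<omega> $ i)" for p \<theta> i
    unfolding W_def vector_add_component vector_scaleR_component real_scaleR_def
    by (intro Bochner_Integration.integrable_add integrable_mult_right intC integrable_const)
  have int_g: "integrable M (g p \<theta>)" for p \<theta>
    unfolding g_def[abs_def] by (rule integrable_f[OF smooth _ intW]) simp
  have int1: "integrable M (\<lambda>\<omega>. f1 i (W p \<theta> \<omega>))" for i p \<theta>
    by (rule integrable_const_bound[of _ L1]) (use f1_bound in auto)
  have int2: "integrable M (\<lambda>\<omega>. f2 i j (W p \<theta> \<omega>))" for i j p \<theta>
    by (rule integrable_const_bound[of _ L2]) (use f2_bound in auto)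
  have g_deriv: "((\<lambda>\<theta>. g p \<theta> \<omega>) has_real_derivative g' p \<theta> \<omega>) (at \<theta>)" for p \<theta> \<omega>
    unfolding g_def g'_def
  proof (rule has_real_derivative_line[OF f_deriv])
    show "((\<lambda>\<theta>. W p \<theta> \<omega>) has_vector_derivative
        (cos \<theta> *\<^sub>R permute_vec p x - (sin \<theta> * sqrt v) *\<^sub>R center (Z \<omega>))) (at \<theta>)"
      unfolding W_def by (auto intro!: derivative_eq_intros simp: has_real_derivative_iff_has_vector_derivative[symmetric] algebra_simps)
  qed
  define b where "b p \<omega> = (\<Sum>i\<in>UNIV. L1 * (\<bar>permute_vec p x $ i\<bar> + sqrt v * \<bar>center (Z \<omega>) $ i\<bar>))" for p \<omega>
  have g'_bound: "\<bar>g' p \<theta> \<omega>\<bar> \<le> b p \<omega>" for p \<theta> \<omega>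
    unfolding g'_def b_def
  proof (intro order.trans[OF sum_abs] sum_mono)
    fix i :: 'n
    let ?y = "permute_vec p x $ i" and ?d = "center (Z \<omega>) $ i"
    have "\<bar>cos \<theta> * ?y - sin \<theta> * sqrt v * ?d\<bar> \<le> \<bar>cos \<theta> * ?y\<bar> + \<bar>sin \<theta> * (sqrt v * ?d)\<bar>"
      by (simp add: abs_triangle_ineq4 mult.assoc)
    also have "\<dots> \<le> \<bar>?y\<bar> + sqrt v * \<bar>?d\<bar>"
      using v by (intro add_mono) (auto simp: abs_mult intro!: mult_left_le_one_le)
    finally show "\<bar>f1 i (W p \<theta> \<omega>) * (cos \<theta> *\<^sub>R permute_vec p x - (sin \<theta> * sqrt v) *\<^sub>R center (Z \<omega>)) $ i\<bar>
        \<le> L1 * (\<bar>?y\<bar> + sqrt v * \<bar>?d\<bar>)"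
      unfolding abs_mult by (intro mult_mono f1_bound L1_nonneg) auto
  qed
  have int_b: "integrable M (b p)" for p
    unfolding b_def[abs_def]
    by (intro Bochner_Integration.integrable_sum integrable_mult_right Bochner_Integration.integrable_add integrable_abs intC) simp
  define \<Phi> where "\<Phi> \<theta> = (\<Sum>p\<in>?P. expectation (g p \<theta>))" for \<theta>
  have \<Phi>_deriv: "(\<Phi> has_real_derivative (\<Sum>p\<in>?P. expectation (g' p \<theta>))) (at \<theta>)" for \<theta>
    unfolding \<Phi>_def
  proof (intro DERIV_sum has_real_derivative_expectation[OF g_deriv int_g _ g'_bound int_b])
    show "g' p \<theta> \<in> borel_measurable M" for p \<theta>
      unfolding g'_def[abs_def] by measurable
  qed
  \<comment> \<open>The Gaussian part of the derivative carries
    \<open>sin \<theta> * sqrt v\<close>, and integration by parts contributes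
    \<open>cos \<theta> * sqrt v / ?N\<close>. Pulling out cos \<theta> leaves v sin \<theta> / n,
    the term subtracted in the discrete identity.\<close>
  have expectation_g': "expectation (g' p \<theta>) = cos \<theta> * expectation (\<lambda>\<omega>.
      (\<Sum>i\<in>UNIV. permute_vec p x $ i * f1 i (W p \<theta> \<omega>)) -
      v / ?N * (\<Sum>i\<in>UNIV. \<Sum>j\<in>UNIV. sin \<theta> * f2 i i (W p \<theta> \<omega>) - sin \<theta> * f2 i j (W p \<theta> \<omega>)))" for p \<theta>
  proof -
    define E1 where "E1 = expectation (\<lambda>\<omega>. \<Sum>i\<in>UNIV. permute_vec p x $ i * f1 i (W p \<theta> \<omega>))"
    define E2 where "E2 i = expectation (\<lambda>\<omega>. \<Sum>k\<in>UNIV. f2 i i (W p \<theta> \<omega>) - f2 i k (W p \<theta> \<omega>))" for i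
    note ibp = gaussian_center_integration_by_parts[OF smooth Z, of _ "a + sin \<theta> *\<^sub>R permute_vec p x" "cos \<theta> * sqrt v",
        folded W_def]
    have "expectation (g' p \<theta>) = expectation (\<lambda>\<omega>. cos \<theta> * (\<Sum>i\<in>UNIV. permute_vec p x $ i * f1 i (W p \<theta> \<omega>))
        - sin \<theta> * sqrt v * (\<Sum>i\<in>UNIV. center (Z \<omega>) $ i * f1 i (W p \<theta> \<omega>)))"
      unfolding g'_def sum_distrib_left sum_subtractf[symmetric]
      by (intro Bochner_Integration.integral_cong refl sum.cong) (simp add: algebra_simps)
    also have "\<dots> = cos \<theta> * E1 - sin \<theta> * sqrt v * (\<Sum>i\<in>UNIV. expectation (\<lambda>\<omega>. center (Z \<omega>) $ i * f1 i (W p \<theta> \<omega>)))"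
      unfolding E1_def using int1 ibp(2) by (simp del: center_nth)
    also have "\<dots> = cos \<theta> * E1 - sin \<theta> * sqrt v * (\<Sum>i\<in>UNIV. cos \<theta> * sqrt v / ?N * E2 i)"
      by (simp only: ibp(1) E2_def)
    also have "\<dots> = cos \<theta> * (E1 - v / ?N * (sin \<theta> * (\<Sum>i\<in>UNIV. E2 i)))"
      unfolding sum_distrib_left[symmetric] using v by (simp add: right_diff_distrib)
    also have "sin \<theta> * (\<Sum>i\<in>UNIV. E2 i) = expectation (\<lambda>\<omega>. \<Sum>i\<in>UNIV. \<Sum>j\<in>UNIV. sin \<theta> * f2 i i (W p \<theta> \<omega>) - sin \<theta> * f2 i j (W p \<theta> \<omega>))"
      unfolding E2_def using int2 by (simp add: sum_distrib_left right_diff_distrib)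
    also have "E1 - v / ?N * \<dots> = expectation (\<lambda>\<omega>.
      (\<Sum>i\<in>UNIV. permute_vec p x $ i * f1 i (W p \<theta> \<omega>)) -
      v / ?N * (\<Sum>i\<in>UNIV. \<Sum>j\<in>UNIV. sin \<theta> * f2 i i (W p \<theta> \<omega>) - sin \<theta> * f2 i j (W p \<theta> \<omega>)))"
      unfolding E1_def using int1 int2
      by (subst Bochner_Integration.integral_diff) auto
    finally show ?thesis .
  qed
  have W_alt: "W p \<theta> \<omega> = (a + (cos \<theta> * sqrt v) *\<^sub>R center (Z \<omega>)) + sin \<theta> *\<^sub>R permute_vec p x" for p \<theta> \<omega>
    by (simp add: W_def algebra_simps)
  \<comment> \<open>An antiderivative of the error bound: 32 sin^2 \<theta> cos \<theta> integrates
    to (32/3) sin^3 \<theta>, and 4 sin \<theta> cos \<theta> to 2 sin^2 \<theta>.\<close>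
  define \<Psi> where "\<Psi> \<theta> = ?c * (32 / 3 * L3 * S * sin \<theta> ^ 3 + 2 * L2 * v * (sin \<theta>)\<^sup>2)" for \<theta> :: real
  define \<Psi>' where "\<Psi>' \<theta> = cos \<theta> * (?c * (16 * (2 * (sin \<theta>)\<^sup>2 * L3) * S + 4 * (sin \<theta> * L2) * v))" for \<theta> :: real
  have "\<bar>\<Phi> (pi / 2) - \<Phi> 0\<bar> \<le> \<Psi> (pi / 2) - \<Psi> 0"
  proof (rule abs_diff_le_of_derivative_bound[OF _ \<Phi>_deriv])
    show "(\<Psi> has_real_derivative \<Psi>' \<theta>) (at \<theta>)" for \<theta>
      unfolding \<Psi>_def \<Psi>'_def
      by (auto intro!: derivative_eq_intros simp: power2_eq_square power3_eq_cube algebra_simps)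
    fix \<theta> :: real assume \<theta>: "0 \<le> \<theta>" "\<theta> \<le> pi / 2"
    have s: "0 \<le> sin \<theta>" and c: "0 \<le> cos \<theta>"
      using \<theta> by (auto intro!: sin_ge_zero cos_ge_zero)
    define R where "R p \<omega> = (\<Sum>i\<in>UNIV. permute_vec p x $ i * f1 i (W p \<theta> \<omega>)) -
      v / ?N * (\<Sum>i\<in>UNIV. \<Sum>j\<in>UNIV. sin \<theta> * f2 i i (W p \<theta> \<omega>) - sin \<theta> * f2 i j (W p \<theta> \<omega>))" for p \<omega>
    have intR: "integrable M (R p)" for p
      unfolding R_def[abs_def] by (intro Bochner_Integration.integrable_diff integrable_mult_right
        Bochner_Integration.integrable_sum int1 int2)
    have "\<bar>\<Sum>p\<in>?P. R p \<omega>\<bar> \<le> ?c * (16 * (2 * (sin \<theta>)\<^sup>2 * L3) * S + 4 * (sin \<theta> * L2) * v)" for \<omega>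
      unfolding R_def W_alt
      using L3_nonneg
      by (intro permutation_integration_by_parts[OF sum_zero sum_squares sum_cubes _
            swap_estimates(1)[OF s] swap_estimates(2)[OF s] swap_estimates(3)[OF s]]) simp
    then have "\<bar>expectation (\<lambda>\<omega>. \<Sum>p\<in>?P. R p \<omega>)\<bar> \<le> ?c * (16 * (2 * (sin \<theta>)\<^sup>2 * L3) * S + 4 * (sin \<theta> * L2) * v)"
      (is "_ \<le> ?r")
      using integral_abs_bound[of M "\<lambda>\<omega>. \<Sum>p\<in>?P. R p \<omega>"] intR
      by (intro order.trans[OF integral_abs_bound] integral_le_const) auto
    moreover have "(\<Sum>p\<in>?P. expectation (g' p \<theta>)) = cos \<theta> * expectation (\<lambda>\<omega>. \<Sum>p\<in>?P. R p \<omega>)"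
      unfolding expectation_g' R_def[symmetric] using intR by (simp add: sum_distrib_left)
    ultimately show "\<bar>\<Sum>p\<in>?P. expectation (g' p \<theta>)\<bar> \<le> \<Psi>' \<theta>"
      unfolding \<Psi>'_def using c by (simp only: abs_mult abs_of_nonneg mult_left_mono)
  qed simp
  then show ?thesis
    by (simp add: \<Phi>_def \<Psi>_def g_def[abs_def] W_def prob_space algebra_simps)
qed

section \<open>Exchangeable vectors\<close>

lemma (in prob_space) integrable_abs_power_le:
  fixes U :: "'a \<Rightarrow> real"
  assumes [measurable]: "U \<in> borel_measurable M" and U: "integrable M (\<lambda>\<omega>. \<bar>U \<omega>\<bar> ^ q)" and "p \<le> q"
  shows "integrable M (\<lambda>\<omega>. \<bar>U \<omega>\<bar> ^ p)"
proof (rule Bochner_Integration.integrable_bound)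
  show "integrable M (\<lambda>\<omega>. 1 + \<bar>U \<omega>\<bar> ^ q)" using U by simp
  have "t ^ p \<le> 1 + t ^ q" if "0 \<le> t" for t :: real
  proof (cases "t \<le> 1")
    case True
    then have "t ^ p \<le> 1" using that by (intro power_le_one)
    then show ?thesis using zero_le_power[OF that, of q] by linarith
  next
    case False
    then have "t ^ p \<le> t ^ q" using \<open>p \<le> q\<close> by (intro power_increasing) auto
    then show ?thesis by linarith
  qed
  then show "AE \<omega> in M. norm (\<bar>U \<omega>\<bar> ^ p) \<le> norm (1 + \<bar>U \<omega>\<bar> ^ q)"
    by (intro always_eventually allI) (simp add: abs_of_nonneg add_nonneg_nonneg)
qed simp

text \<open>The mean is bounded by the largest |x_j|, so a centered coordinate is at most twice
  that. The crude constant is harmless because the bound is used only for integrability.\<close>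

lemma abs_center_power_le:
  fixes x :: "real ^ 'n"
  shows "\<bar>center x $ i\<bar> ^ q \<le> 2 ^ q * (\<Sum>j\<in>UNIV. \<bar>x $ j\<bar> ^ q)"
proof -
  define B where "B = Max (range (\<lambda>j. \<bar>x $ j\<bar>))"
  have B: "\<bar>x $ j\<bar> \<le> B" for j by (auto simp: B_def)
  have "B \<in> range (\<lambda>j. \<bar>x $ j\<bar>)" unfolding B_def by (rule Max_in) auto
  then obtain j where j: "B = \<bar>x $ j\<bar>" by auto
  have "\<bar>\<Sum>j\<in>UNIV. x $ j\<bar> \<le> (\<Sum>j\<in>(UNIV :: 'n set). B)"
    by (intro order.trans[OF sum_abs] sum_mono B)
  then have "\<bar>emp_mean x\<bar> \<le> B" by (simp add: emp_mean_def field_simps)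
  then have "\<bar>center x $ i\<bar> \<le> 2 * B" using B[of i] by simp
  then have "\<bar>center x $ i\<bar> ^ q \<le> (2 * B) ^ q" by (intro power_mono) auto
  also have "\<dots> = 2 ^ q * \<bar>x $ j\<bar> ^ q" by (simp add: j power_mult_distrib)
  also have "\<dots> \<le> 2 ^ q * (\<Sum>j\<in>UNIV. \<bar>x $ j\<bar> ^ q)"
    by (intro mult_left_mono member_le_sum) auto
  finally show ?thesis .
qed

lemma borel_measurable_emp_mean [measurable]: "emp_mean \<in> borel_measurable borel"
  by (intro borel_measurable_continuous_onI continuous_intros)

lemma emp_sd_eq: "emp_sd x = sqrt ((\<Sum>i\<in>UNIV. (center x $ i)\<^sup>2) / real CARD('n))" for x :: "real ^ 'n"
  by (simp add: emp_sd_def)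

lemma borel_measurable_emp_sd [measurable]: "emp_sd \<in> borel_measurable borel"
  unfolding emp_sd_eq[abs_def] by (intro borel_measurable_continuous_onI continuous_intros) simp

lemma emp_sd_squared: "(emp_sd x)\<^sup>2 = (\<Sum>i\<in>UNIV. (center x $ i)\<^sup>2) / real CARD('n)" for x :: "real ^ 'n"
  unfolding emp_sd_eq by (simp add: sum_nonneg del: center_nth)

lemma emp_sd_nonneg: "0 \<le> emp_sd x" for x :: "real ^ 'n"
  unfolding emp_sd_eq by (simp add: sum_nonneg del: center_nth)

lemma (in prob_space) integrable_center_power:
  fixes V :: "'a \<Rightarrow> real ^ 'n"
  assumes [measurable]: "V \<in> borel_measurable M"
    and V: "\<And>i. integrable M (\<lambda>\<omega>. \<bar>V \<omega> $ i\<bar> ^ q)" and "p \<le> q"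
  shows "integrable M (\<lambda>\<omega>. \<bar>center (V \<omega>) $ i\<bar> ^ p)"
proof (rule integrable_abs_power_le[OF _ _ \<open>p \<le> q\<close>])
  show "integrable M (\<lambda>\<omega>. \<bar>center (V \<omega>) $ i\<bar> ^ q)"
  proof (rule Bochner_Integration.integrable_bound)
    show "integrable M (\<lambda>\<omega>. 2 ^ q * (\<Sum>j\<in>UNIV. \<bar>V \<omega> $ j\<bar> ^ q))"
      by (intro integrable_mult_right Bochner_Integration.integrable_sum V)
    show "AE \<omega> in M. norm (\<bar>center (V \<omega>) $ i\<bar> ^ q) \<le> norm (2 ^ q * (\<Sum>j\<in>UNIV. \<bar>V \<omega> $ j\<bar> ^ q))"
      using order.trans[OF abs_center_power_le abs_ge_self]
      by (intro always_eventually allI) (simp add: power_abs del: center_nth)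
  qed measurable
qed measurable

lemma emp_mean_permute_vec:
  fixes x :: "real ^ 'n"
  assumes "p permutes UNIV"
  shows "emp_mean (permute_vec p x) = emp_mean x"
  using sum_permute_vec_nth[OF assms, of "\<lambda>t. t" x] by (simp add: emp_mean_def)

lemma (in prob_space) exchangeable_expectation:
  fixes X :: "'a \<Rightarrow> real ^ 'n" and h :: "real ^ 'n \<Rightarrow> real"
  assumes X: "exchangeable M X" and [measurable]: "X \<in> borel_measurable M" "h \<in> borel_measurable borel"
    and p: "p permutes UNIV"
  shows "expectation (\<lambda>\<omega>. h (permute_vec p (X \<omega>))) = expectation (\<lambda>\<omega>. h (X \<omega>))"
proof -
  have [measurable]: "(\<lambda>\<omega>. permute_vec p (X \<omega>)) \<in> borel_measurable M"
    by (rule borel_measurable_vecI) simp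
  have "distr M borel (\<lambda>\<omega>. permute_vec p (X \<omega>)) = distr M borel X"
    using X p by (simp add: exchangeable_def permute_vec_def)
  then have "integral\<^sup>L (distr M borel (\<lambda>\<omega>. permute_vec p (X \<omega>))) h = integral\<^sup>L (distr M borel X) h"
    by simp
  then show ?thesis by (simp add: integral_distr)
qed

text \<open>The empirical mean is invariant under permutations, so an exchange of two coordinates
  carries one centered coordinate to the other. Hence the moments \<open>m p\<close> do not depend
  on the coordinate chosen to define them.\<close>

lemma (in prob_space) exchangeable_central_moment:
  fixes X :: "'a \<Rightarrow> real ^ 'n"
  assumes X: "exchangeable M X" "X \<in> borel_measurable M"
  shows "expectation (\<lambda>\<omega>. \<bar>center (X \<omega>) $ i\<bar> ^ q) = expectation (\<lambda>\<omega>. \<bar>center (X \<omega>) $ k\<bar> ^ q)"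
proof -
  let ?t = "Transposition.transpose k i"
  have t: "?t permutes UNIV" by (rule permutes_swap_id) auto
  have "expectation (\<lambda>\<omega>. \<bar>center (permute_vec ?t (X \<omega>)) $ k\<bar> ^ q) = expectation (\<lambda>\<omega>. \<bar>center (X \<omega>) $ k\<bar> ^ q)"
    by (rule exchangeable_expectation[OF X _ t]) measurable
  then show ?thesis by (simp add: emp_mean_permute_vec[OF t])
qed

text \<open>\<open>iter_partial\<close> differentiates in the last listed variable first, so the
  derivative in i and then j is the list \<open>[j, i]\<close>. The bound on third derivatives
  becomes the Lipschitz constant of the second ones.\<close>

lemma smooth_function_of_cont_diff:
  fixes f :: "real ^ 'n \<Rightarrow> real"
  assumes f: "cont_diff 3 f" and bd: "\<And>r. r \<in> {1, 2, 3} \<Longrightarrow> bounds_partials r f (L r)"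
  shows "smooth_function f (\<lambda>i. partial_deriv i f) (\<lambda>i j. partial_deriv j (partial_deriv i f)) (L 1) (L 2) (L 3)"
proof -
  have c3: "cont_diff (Suc (Suc (Suc 0))) f" using f by (simp add: numeral_3_eq_3)
  then have c2: "cont_diff (Suc (Suc 0)) (partial_deriv i f)" for i by simp
  then have c1: "cont_diff (Suc 0) (partial_deriv j (partial_deriv i f))" for i j by simp
  have b1: "\<bar>partial_deriv i f x\<bar> \<le> L 1" for i x
    using bd[of 1] by (auto simp: bounds_partials_def dest: spec[of _ "[i]"])
  have b2: "\<bar>partial_deriv j (partial_deriv i f) x\<bar> \<le> L 2" for i j x
    using bd[of 2] by (auto simp: bounds_partials_def dest: spec[of _ "[j, i]"])
  have b3: "\<bar>partial_deriv k (partial_deriv j (partial_deriv i f)) x\<bar> \<le> L 3" for i j k x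
    using bd[of 3] by (auto simp: bounds_partials_def dest: spec[of _ "[k, j, i]"])
  show ?thesis
  proof
    show "\<bar>partial_deriv j (partial_deriv i f) u - partial_deriv j (partial_deriv i f) v\<bar>
        \<le> L 3 * (\<Sum>k\<in>UNIV. \<bar>u $ k - v $ k\<bar>)" for i j u v
      by (rule l1_lipschitz[OF has_derivative_continuous_partials[OF c1] b3])
    show "0 \<le> L 3" using order.trans[OF abs_ge_zero b3] .
    show "continuous_on UNIV (partial_deriv j (partial_deriv i f))" for i j
      using c1 by (rule cont_diff_continuous)
  qed (rule has_derivative_continuous_partials[OF c3] has_derivative_continuous_partials[OF c2] b1 b2)+
qed

theorem theorem1p2:
  fixes M :: "'a measure"
    and X Y Z :: "'a \<Rightarrow> real ^ 'n"
    and f :: "real ^ 'n \<Rightarrow> real"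
    and L m :: "nat \<Rightarrow> real"
    and k :: 'n
  assumes "prob_space M"
    and "X \<in> borel_measurable M"
    and "exchangeable M X"
    and "\<And>i. integrable M (\<lambda>\<omega>. (X \<omega> $ i) ^ 4)"
    and "Z \<in> borel_measurable M"
    and "standard_gaussian M Z"
    and "prob_space.indep_var M borel X borel Z"
    and "\<And>\<omega> i. Y \<omega> $ i = emp_mean (X \<omega>) + emp_sd (X \<omega>) * (Z \<omega> $ i - emp_mean (Z \<omega>))"
    and "cont_diff 3 f"
    and "\<And>r. r \<in> {1, 2, 3} \<Longrightarrow> bounds_partials r f (L r)"
    and "\<And>p. m p = prob_space.expectation M (\<lambda>\<omega>. \<bar>X \<omega> $ k - emp_mean (X \<omega>)\<bar> ^ p)"
  shows "\<bar>prob_space.expectation M (\<lambda>\<omega>. f (X \<omega>)) - prob_space.expectation M (\<lambda>\<omega>. f (Y \<omega>))\<bar>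
           \<le> 9.5 * m 4 powr (1 / 2) * L 2 * real CARD('n) powr (1 / 2)
             + 13 * m 3 * L 3 * real CARD('n)"
proof -
  interpret prob_space M by fact
  note [measurable] = assms(2,5)
  have smooth: "smooth_function f (\<lambda>i. partial_deriv i f) (\<lambda>i j. partial_deriv j (partial_deriv i f)) (L 1) (L 2) (L 3)"
    using assms(9,10) by (rule smooth_function_of_cont_diff)
  interpret smooth_function f "\<lambda>i. partial_deriv i f" "\<lambda>i j. partial_deriv j (partial_deriv i f)" "L 1" "L 2" "L 3"
    by (rule smooth)
  let ?N = "real CARD('n)" and ?P = "perms :: ('n \<Rightarrow> 'n) set"
  let ?c = "real (card ?P)"
  have N: "1 \<le> ?N" by (simp add: Suc_leI)
  have X4: "integrable M (\<lambda>\<omega>. \<bar>X \<omega> $ i\<bar> ^ 4)" for i using assms(4)[of i] by simp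
  have Z4: "integrable M (\<lambda>\<omega>. \<bar>Z \<omega> $ i\<bar> ^ 4)" for i
    using standard_gaussian_integrable[OF assms(6), of i 4] by simp
  have intX: "integrable M (\<lambda>\<omega>. X \<omega> $ i)" for i
    using integrable_abs_power_le[OF _ X4, of i 1] by (simp add: integrable_abs_iff)
  have intCX: "integrable M (\<lambda>\<omega>. \<bar>center (X \<omega>) $ i\<bar> ^ p)" if "p \<le> 4" for i p
    by (rule integrable_center_power[OF assms(2) X4 that])
  have intCZ: "integrable M (\<lambda>\<omega>. (center (Z \<omega>) $ i)\<^sup>2)" for i
    using integrable_center_power[OF assms(5) Z4, of 2 i] by (simp del: center_nth)
  have m: "expectation (\<lambda>\<omega>. \<bar>center (X \<omega>) $ i\<bar> ^ p) = m p" for i p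
    using exchangeable_central_moment[OF assms(3,2), of i p k] by (simp add: assms(11))
  have intX2: "integrable M (\<lambda>\<omega>. (center (X \<omega>) $ i)\<^sup>2)" for i
    using intCX[of 2 i] by (simp del: center_nth)
  have int_sd: "integrable M (\<lambda>\<omega>. (emp_sd (X \<omega>))\<^sup>2)"
    unfolding emp_sd_squared by (intro integrable_divide Bochner_Integration.integrable_sum intX2)
  have exp_sd: "expectation (\<lambda>\<omega>. (emp_sd (X \<omega>))\<^sup>2) = m 2"
  proof -
    have "expectation (\<lambda>\<omega>. (center (X \<omega>) $ i)\<^sup>2) = m 2" for i
      using m[of i 2] by (simp del: center_nth)
    then show ?thesis unfolding emp_sd_squared using intX2 by (simp del: center_nth)
  qed

  define G where "G = (\<lambda>(x :: real ^ 'n, z). f ((\<chi> i. emp_mean x) + emp_sd x *\<^sub>R center z))"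
  have vec_meas: "(\<lambda>x. \<chi> i. emp_mean x) \<in> borel_measurable (borel :: (real ^ 'n) measure)"
    by (rule borel_measurable_vecI) simp
  have G_meas: "G \<in> borel_measurable (borel \<Otimes>\<^sub>M borel)"
    unfolding G_def using vec_meas by measurable
  have Y: "Y \<omega> = (\<chi> i. emp_mean (X \<omega>)) + emp_sd (X \<omega>) *\<^sub>R center (Z \<omega>)" for \<omega>
    by (simp add: vec_eq_iff assms(8))
  have Y_meas: "Y \<in> borel_measurable M"
    by (rule borel_measurable_vecI) (simp add: Y)
  have intY: "integrable M (\<lambda>\<omega>. Y \<omega> $ i)" for i
  proof -
    have "integrable M (\<lambda>\<omega>. emp_sd (X \<omega>) * center (Z \<omega>) $ i)"
    proof (rule Bochner_Integration.integrable_bound)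
      show "integrable M (\<lambda>\<omega>. (emp_sd (X \<omega>))\<^sup>2 + (center (Z \<omega>) $ i)\<^sup>2)"
        by (intro Bochner_Integration.integrable_add int_sd intCZ)
      have "\<bar>a * b\<bar> \<le> a\<^sup>2 + b\<^sup>2" for a b :: real
      proof -
        have "2 * \<bar>a * b\<bar> \<le> a\<^sup>2 + b\<^sup>2"
          using zero_le_power2[of "\<bar>a\<bar> - \<bar>b\<bar>"] by (simp add: power2_diff abs_mult)
        then show ?thesis using abs_ge_zero[of "a * b"] by linarith
      qed
      then show "AE \<omega> in M. norm (emp_sd (X \<omega>) * center (Z \<omega>) $ i) \<le> norm ((emp_sd (X \<omega>))\<^sup>2 + (center (Z \<omega>) $ i)\<^sup>2)"
        by (intro always_eventually allI) (simp add: abs_of_nonneg del: center_nth)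
    qed measurable
    moreover have "integrable M (\<lambda>\<omega>. emp_mean (X \<omega>))"
      unfolding emp_mean_def by (intro integrable_mult_right Bochner_Integration.integrable_sum intX)
    ultimately show ?thesis by (simp add: Y del: center_nth)
  qed
  have intfY: "integrable M (\<lambda>\<omega>. f (Y \<omega>))" by (rule integrable_f[OF smooth Y_meas intY])
  \<comment> \<open>The conditional expectation of \<open>f (Y \<omega>)\<close> given
    \<open>X\<close>: with the value of \<open>X\<close> frozen, the comparison for a fixed vector
    applies.\<close>
  define I where "I \<omega> = expectation (\<lambda>\<omega>'. G (X \<omega>, Z \<omega>'))" for \<omega>
  have G_int: "integrable M (\<lambda>\<omega>. G (X \<omega>, Z \<omega>))" using intfY by (simp add: G_def Y)
  have fY: "expectation (\<lambda>\<omega>. f (Y \<omega>)) = expectation I" and int_I: "integrable M I"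
    using indep_var_expectation[OF assms(7) G_meas G_int] by (simp_all add: I_def[abs_def] G_def Y)

  have int_perm: "integrable M (\<lambda>\<omega>. f (permute_vec p (X \<omega>)))" for p
    by (rule integrable_f[OF smooth]) (auto intro!: borel_measurable_vecI intX)
  \<comment> \<open>Exchangeability enters the comparison here: every permutation of
    \<open>X\<close> gives the same expectation. Conditioning on the empirical distribution is thus
    replaced by a finite sum inside the expectation.\<close>
  have fX: "?c * expectation (\<lambda>\<omega>. f (X \<omega>)) = expectation (\<lambda>\<omega>. \<Sum>p\<in>?P. f (permute_vec p (X \<omega>)))"
    using int_perm exchangeable_expectation[OF assms(3,2) f_measurable]
    by (simp add: perms_def)

  define b where "b \<omega> = 32 / 3 * L 3 * (\<Sum>i\<in>UNIV. \<bar>center (X \<omega>) $ i\<bar> ^ 3) + 2 * L 2 * (emp_sd (X \<omega>))\<^sup>2" for \<omega>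
  have int3: "integrable M (\<lambda>\<omega>. \<Sum>i\<in>UNIV. \<bar>center (X \<omega>) $ i\<bar> ^ 3)"
    by (intro Bochner_Integration.integrable_sum intCX) simp
  have pointwise: "\<bar>(\<Sum>p\<in>?P. f (permute_vec p (X \<omega>))) - ?c * I \<omega>\<bar> \<le> ?c * b \<omega>" for \<omega>
  proof -
    let ?x = "center (X \<omega>)" and ?a = "(\<chi> i. emp_mean (X \<omega>)) :: real ^ 'n"
    have "(\<Sum>i\<in>UNIV. ?x $ i) = 0" by (simp add: sum_subtractf emp_mean_def)
    moreover have "(\<Sum>i\<in>UNIV. (?x $ i)\<^sup>2) = ?N * (emp_sd (X \<omega>))\<^sup>2"
      unfolding emp_sd_squared by simp
    moreover have "?a + permute_vec p ?x = permute_vec p (X \<omega>)" for p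
      by (simp add: vec_eq_iff)
    ultimately show ?thesis
      \<comment> \<open>The constant vector of the empirical mean is fixed by all permutations, so
        it becomes the translation \<open>a\<close> and the centered part is what gets
        permuted.\<close>
      using permutation_gaussian_comparison[OF smooth assms(6,5), of ?x "(emp_sd (X \<omega>))\<^sup>2" _ ?a, OF _ _ refl]
      by (simp add: I_def G_def b_def emp_sd_nonneg del: center_nth)
  qed
  have "?c * (expectation (\<lambda>\<omega>. f (X \<omega>)) - expectation (\<lambda>\<omega>. f (Y \<omega>)))
      = expectation (\<lambda>\<omega>. (\<Sum>p\<in>?P. f (permute_vec p (X \<omega>))) - ?c * I \<omega>)"
    unfolding right_diff_distrib fX fY using int_perm int_I by simp
  also have "\<bar>\<dots>\<bar> \<le> expectation (\<lambda>\<omega>. ?c * b \<omega>)"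
    unfolding b_def using int_perm int_I int3 int_sd pointwise
    by (intro order.trans[OF integral_abs_bound] integral_mono integrable_abs) (auto simp: b_def simp del: center_nth)
  also have "\<dots> = ?c * (32 / 3 * L 3 * (?N * m 3) + 2 * L 2 * m 2)"
    unfolding b_def using intCX[of 3] int_sd by (simp add: exp_sd m del: center_nth)
  finally have main: "\<bar>expectation (\<lambda>\<omega>. f (X \<omega>)) - expectation (\<lambda>\<omega>. f (Y \<omega>))\<bar>
      \<le> 32 / 3 * L 3 * (?N * m 3) + 2 * L 2 * m 2"
    using card_perms_pos[where 'n = 'n] by (simp only: abs_mult abs_of_nat) simp

  have m_nonneg: "0 \<le> m p" for p unfolding assms(11) by simp
  have "(m 2)\<^sup>2 \<le> m 4"
  proof -
    let ?A = "\<lambda>\<omega>. \<bar>center (X \<omega>) $ k\<bar>\<^sup>2"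
    have A: "integrable M ?A" "integrable M (\<lambda>\<omega>. (?A \<omega>)\<^sup>2)"
      using intCX[of 2 k] intCX[of 4 k] by (simp_all del: center_nth power2_abs flip: power_mult)
    \<comment> \<open>Nonnegativity of the variance of the squared centered coordinate.\<close>
    have "(expectation ?A)\<^sup>2 \<le> expectation (\<lambda>\<omega>. (?A \<omega>)\<^sup>2)"
      using variance_positive[of ?A] variance_eq[OF A] by linarith
    then show ?thesis using m[of k 2] m[of k 4] by (simp del: center_nth power2_abs flip: power_mult)
  qed
  then have "m 2 \<le> m 4 powr (1 / 2)"
    using m_nonneg by (simp add: powr_half_sqrt real_le_rsqrt)
  \<comment> \<open>The argument yields the second-derivative term without a power of n; the factor
    n^(1/2) of the claim is at least 1 and is inserted only here.\<close>
  also have "\<dots> \<le> m 4 powr (1 / 2) * ?N powr (1 / 2)"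
    using mult_left_mono[OF ge_one_powr_ge_zero[OF N], of "1 / 2" "m 4 powr (1 / 2)"] by simp
  finally have "2 * L 2 * m 2 \<le> 2 * L 2 * (m 4 powr (1 / 2) * ?N powr (1 / 2))"
    using L2_nonneg by (intro mult_left_mono) auto
  also have "\<dots> \<le> 9.5 * L 2 * (m 4 powr (1 / 2) * ?N powr (1 / 2))"
    using L2_nonneg by (intro mult_right_mono) auto
  finally have "2 * L 2 * m 2 \<le> 9.5 * m 4 powr (1 / 2) * L 2 * ?N powr (1 / 2)"
    by (simp only: mult_ac)
  moreover have "32 / 3 * (L 3 * (?N * m 3)) \<le> 13 * (L 3 * (?N * m 3))"
    using L3_nonneg m_nonneg by (intro mult_right_mono mult_nonneg_nonneg) auto
  then have "32 / 3 * L 3 * (?N * m 3) \<le> 13 * m 3 * L 3 * ?N"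
    by (simp only: mult_ac)
  ultimately show ?thesis using main by linarith
qed

end
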